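(* The triple $\Gamma=(\overline{\mathbf{Gr}},\mathrm{Trees},\{\mathrm{Disc}(n)\}_{n\ge0})$ is a width category. Furthermore, for every graph $G$, the $\Gamma$-width of $G$ is its complemented treewidth: $\mathbf{w}_\Gamma(G)=\overline{\mathbf{tw}}(G)$.
   Context: Graphs: a graph $G$ is a finite vertex set $V(G)$ with a symmetric irreflexive relation $E(G)\subseteq V(G)^2$ (finite sets are taken from a fixed small skeleton). $\overline{\mathbf{Gr}}$ is the category whose objects are graphs and whose morphisms $f:G\to H$ (reflexive graph homomorphisms) are functions $f:V(G)\to V(H)$ such that whenever $f(x)f(y)$ is an edge of $H$, $xy$ is an edge of $G$. $\mathrm{Disc}(n)$ is the graph with $n$ vertices and no edges. A tree is a nonempty connected graph with no cycles; $\mathrm{Trees}$ is the set of all (finite) trees. For a graph $G$, the category $\int G$ has as objects the vertices and the (unordered) edges of $G$; its only non-identity morphisms are, for each edge $e=xy$, two morphisms $e_x:e\to x$ and $e_y:e\to y$. Structured decompositions: for a set $\mathcal{G}$ of graphs, a $\mathcal{G}$-structured decomposition in a category $\mathcal{C}$ is a functor $d:\int G\to\mathcal{C}$, $G\in\mathcal{G}$, sending every morphism to a monomorphism; the $d(v)$, $v\in V(G)$, are its bags. It is a decomposition of an object $X$ if $X\cong\operatorname{colim} d$. Spined sd-category: a triple $(\mathcal{C},\mathcal{G},\Omega)$ with $\mathcal{C}$ a small category, $\mathcal{G}$ a set of graphs containing the one-vertex graph, such that (W1) every $\mathcal{G}$-structured decomposition has a colimit in $\mathcal{C}$; and $\Omega=\bigcup_{n\ge0}\Omega_n$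 a full subcategory closed under isomorphism, filtered by full subcategories $\Omega_0\subseteq\Omega_1\subseteq\cdots$ closed under isomorphism, such that (W2a) every object admits a monomorphism into some object of $\Omega$; (W2b) for $n\ge1$ and $W\in\Omega_n\setminus\Omega_{n-1}$ there is no monomorphism from $W$ into an object of $\Omega_{n-1}$. The notation $\{\mathrm{Disc}(n)\}_{n\ge0}$ denotes the spine where $\Omega_n$ consists of the objects isomorphic to $\mathrm{Disc}(m)$ for some $m\le n$. Width category: a spined sd-category in which pullbacks of monomorphisms along arbitrary morphisms exist and (W3) for every $\mathcal{G}$-structured decomposition $d$ of an object $Y$ and every monomorphism $f:X\to Y$, the pullback along $f$ of the colimit cocone $(d(i)\to Y)_i$ (objects $X\times_Y d(i)$, with projections to $X$) exists and is a colimit cocone with apex $X$. $\Gamma$-width: $s(X)$ is the smallest $n$ such that there is a monomorphism from $X$ into an object of $\Omega_n$; $w(d)=\max_{x\in V(G)}s(d(x))-1$ for $d:\int G\to\mathcal{C}$; $\mathbf{w}_\Gamma(X)=\min_d w(d)$ over all $\mathcal{G}$-structured decompositions $d$ of $X$. Complemented treewidth: $\overline{\mathbf{tw}}(G)=\mathbf{tw}(\overline{G})$, where $\overline{G}$ is the complement of $G$ (same vertices; distinct vertices are adjacent in $\overline{G}$ iff they are not adjacent in $G$). Here $\mathbf{tw}$ is usual treewidth: a tree decomposition of $G$ is a tree $T$ with $X:V(T)\to P(V(G))$ such that the $X(t)$ cover $V(G)$, every edge has both ends in some $X(t)$, and $X(t_1)\cap X(t_3)\subseteq X(t_2)$ whenever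 $t_2$ lies on the path between $t_1$ and $t_3$; its width is $\max_t|X(t)|-1$ and $\mathbf{tw}(G)$ is the minimum width. *)

theory Defs
  imports "Graph_Theory.Digraph_Component" "HOL-Library.FuncSet"
begin

section \<open>Categories\<close>

text \<open>Smallness is automatic, since the objects and the arrows form sets.\<close>

record ('o, 'm) cat =
  Ob :: "'o set"
  Ar :: "'m set"
  Dom :: "'m \<Rightarrow> 'o"
  Cod :: "'m \<Rightarrow> 'o"
  Id :: "'o \<Rightarrow> 'm"
  Comp :: "'m \<Rightarrow> 'm \<Rightarrow> 'm"  (infixl "\<odot>\<index>" 70)

locale category =
  fixes C :: "('o, 'm) cat" (structure)
  assumes Dom_in: "f \<in> Ar C \<Longrightarrow> Dom C f \<in> Ob C"
    and Cod_in: "f \<in> Ar C \<Longrightarrow> Cod C f \<in> Ob C"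
    and Id_in: "X \<in> Ob C \<Longrightarrow> Id C X \<in> Ar C"
    and Dom_Id: "X \<in> Ob C \<Longrightarrow> Dom C (Id C X) = X"
    and Cod_Id: "X \<in> Ob C \<Longrightarrow> Cod C (Id C X) = X"
    and Comp_in: "\<lbrakk>f \<in> Ar C; g \<in> Ar C; Cod C f = Dom C g\<rbrakk> \<Longrightarrow> g \<odot> f \<in> Ar C"
    and Dom_Comp: "\<lbrakk>f \<in> Ar C; g \<in> Ar C; Cod C f = Dom C g\<rbrakk> \<Longrightarrow> Dom C (g \<odot> f) = Dom C f"
    and Cod_Comp: "\<lbrakk>f \<in> Ar C; g \<in> Ar C; Cod C f = Dom C g\<rbrakk> \<Longrightarrow> Cod C (g \<odot> f) = Cod C g"
    and Comp_Id: "f \<in> Ar C \<Longrightarrow> f \<odot> Id C (Dom C f) = f"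
    and Id_Comp: "f \<in> Ar C \<Longrightarrow> Id C (Cod C f) \<odot> f = f"
    and Comp_assoc: "\<lbrakk>f \<in> Ar C; g \<in> Ar C; h \<in> Ar C; Cod C f = Dom C g; Cod C g = Dom C h\<rbrakk>
          \<Longrightarrow> (h \<odot> g) \<odot> f = h \<odot> (g \<odot> f)"

definition hom_set :: "('o, 'm) cat \<Rightarrow> 'o \<Rightarrow> 'o \<Rightarrow> 'm set" where
  "hom_set C X Y = {f \<in> Ar C. Dom C f = X \<and> Cod C f = Y}"

definition monic :: "('o, 'm) cat \<Rightarrow> 'm \<Rightarrow> bool" where
  "monic C f \<longleftrightarrow> f \<in> Ar C \<and>
     (\<forall>Z \<in> Ob C. \<forall>g \<in> hom_set C Z (Dom C f). \<forall>h \<in> hom_set C Z (Dom C f).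
        f \<odot>\<^bsub>C\<^esub> g = f \<odot>\<^bsub>C\<^esub> h \<longrightarrow> g = h)"

definition isomorphic :: "('o, 'm) cat \<Rightarrow> 'o \<Rightarrow> 'o \<Rightarrow> bool" where
  "isomorphic C X Y \<longleftrightarrow>
     (\<exists>f \<in> hom_set C X Y. \<exists>g \<in> hom_set C Y X. g \<odot>\<^bsub>C\<^esub> f = Id C X \<and> f \<odot>\<^bsub>C\<^esub> g = Id C Y)"

definition is_pullback :: "('o, 'm) cat \<Rightarrow> 'm \<Rightarrow> 'm \<Rightarrow> 'o \<Rightarrow> 'm \<Rightarrow> 'm \<Rightarrow> bool" where
  "is_pullback C f g P p q \<longleftrightarrow>
     f \<in> Ar C \<and> g \<in> Ar C \<and> Cod C f = Cod C g \<and> P \<in> Ob C \<and>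
     p \<in> hom_set C P (Dom C f) \<and> q \<in> hom_set C P (Dom C g) \<and> f \<odot>\<^bsub>C\<^esub> p = g \<odot>\<^bsub>C\<^esub> q \<and>
     (\<forall>Q \<in> Ob C. \<forall>a \<in> hom_set C Q (Dom C f). \<forall>b \<in> hom_set C Q (Dom C g).
        f \<odot>\<^bsub>C\<^esub> a = g \<odot>\<^bsub>C\<^esub> b \<longrightarrow>
        (\<exists>!u. u \<in> hom_set C Q P \<and> p \<odot>\<^bsub>C\<^esub> u = a \<and> q \<odot>\<^bsub>C\<^esub> u = b))"

record ('i, 'j, 'o, 'm) diagram =
  fobj :: "'i \<Rightarrow> 'o"
  farr :: "'j \<Rightarrow> 'm"

definition is_functor ::
    "('i, 'j) cat \<Rightarrow> ('o, 'm) cat \<Rightarrow> ('i, 'j, 'o, 'm) diagram \<Rightarrow> bool" where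
  "is_functor J C d \<longleftrightarrow>
     (\<forall>i \<in> Ob J. fobj d i \<in> Ob C) \<and>
     (\<forall>u \<in> Ar J. farr d u \<in> hom_set C (fobj d (Dom J u)) (fobj d (Cod J u))) \<and>
     (\<forall>i \<in> Ob J. farr d (Id J i) = Id C (fobj d i)) \<and>
     (\<forall>u \<in> Ar J. \<forall>v \<in> Ar J. Cod J u = Dom J v \<longrightarrow>
        farr d (v \<odot>\<^bsub>J\<^esub> u) = farr d v \<odot>\<^bsub>C\<^esub> farr d u)"

definition is_cocone ::
    "('i, 'j) cat \<Rightarrow> ('o, 'm) cat \<Rightarrow> ('i, 'j, 'o, 'm) diagram \<Rightarrow> 'o \<Rightarrow> ('i \<Rightarrow> 'm) \<Rightarrow> bool" where
  "is_cocone J C d X \<iota> \<longleftrightarrow>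
     X \<in> Ob C \<and> (\<forall>i \<in> Ob J. \<iota> i \<in> hom_set C (fobj d i) X) \<and>
     (\<forall>u \<in> Ar J. \<iota> (Cod J u) \<odot>\<^bsub>C\<^esub> farr d u = \<iota> (Dom J u))"

definition is_colimit ::
    "('i, 'j) cat \<Rightarrow> ('o, 'm) cat \<Rightarrow> ('i, 'j, 'o, 'm) diagram \<Rightarrow> 'o \<Rightarrow> ('i \<Rightarrow> 'm) \<Rightarrow> bool" where
  "is_colimit J C d X \<iota> \<longleftrightarrow>
     is_cocone J C d X \<iota> \<and>
     (\<forall>Y \<kappa>. is_cocone J C d Y \<kappa> \<longrightarrow>
        (\<exists>!u. u \<in> hom_set C X Y \<and> (\<forall>i \<in> Ob J. u \<odot>\<^bsub>C\<^esub> \<iota> i = \<kappa> i)))"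

text \<open>
  The cocone \<open>p\<close> on the diagram \<open>d'\<close>, with apex \<open>Dom C f\<close>, is a pullback along \<open>f\<close> of the
  cocone \<open>\<iota>\<close> on \<open>d\<close>. The last two conditions say that \<open>p\<close> and \<open>q\<close> are natural; they determine
  the action of \<open>d'\<close> on arrows as the maps induced between the pullbacks.
\<close>

definition is_pullback_cocone ::
    "('i, 'j) cat \<Rightarrow> ('o, 'm) cat \<Rightarrow> ('i, 'j, 'o, 'm) diagram \<Rightarrow> ('i \<Rightarrow> 'm) \<Rightarrow> 'm \<Rightarrow>
     ('i, 'j, 'o, 'm) diagram \<Rightarrow> ('i \<Rightarrow> 'm) \<Rightarrow> ('i \<Rightarrow> 'm) \<Rightarrow> bool" where
  "is_pullback_cocone J C d \<iota> f d' p q \<longleftrightarrow>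
     is_functor J C d' \<and>
     (\<forall>i \<in> Ob J. is_pullback C f (\<iota> i) (fobj d' i) (p i) (q i)) \<and>
     (\<forall>u \<in> Ar J. q (Cod J u) \<odot>\<^bsub>C\<^esub> farr d' u = farr d u \<odot>\<^bsub>C\<^esub> q (Dom J u)) \<and>
     (\<forall>u \<in> Ar J. p (Cod J u) \<odot>\<^bsub>C\<^esub> farr d' u = p (Dom J u))"


section \<open>Graphs\<close>

text \<open>The skeleton of finite sets consists of the sets \<open>{..<n}\<close>.\<close>

definition graphs :: "nat pair_pre_digraph set" where
  "graphs = {G. pair_graph G \<and> (\<exists>n. pverts G = {..<n})}"

definition Disc :: "nat \<Rightarrow> nat pair_pre_digraph" where
  "Disc n = \<lparr>pverts = {..<n}, parcs = {}\<rparr>"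

definition complement :: "'a pair_pre_digraph \<Rightarrow> 'a pair_pre_digraph" where
  "complement G = \<lparr>pverts = pverts G,
     parcs = {(x, y). x \<in> pverts G \<and> y \<in> pverts G \<and> x \<noteq> y \<and> (x, y) \<notin> parcs G}\<rparr>"

text \<open>
  An edge of an undirected graph is represented by two opposite arcs, which form a directed
  cycle of length 2; the library predicate \<open>tree\<close> therefore excludes every graph with an edge.
  The undirected cycles are the directed cycles of length at least 3.
\<close>

definition Trees :: "nat pair_pre_digraph set" where
  "Trees = {T \<in> graphs. Digraph_Component.connected (with_proj T) \<and>
     \<not> (\<exists>c. pre_digraph.cycle (with_proj T) c \<and> 3 \<le> length c)}"

definition tree_decomposition ::
    "'a pair_pre_digraph \<Rightarrow> nat pair_pre_digraph \<Rightarrow> (nat \<Rightarrow> 'a set) \<Rightarrow> bool" where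
  "tree_decomposition G T X \<longleftrightarrow>
     T \<in> Trees \<and>
     (\<forall>t \<in> pverts T. X t \<subseteq> pverts G) \<and>
     pverts G \<subseteq> (\<Union>t \<in> pverts T. X t) \<and>
     (\<forall>(x, y) \<in> parcs G. \<exists>t \<in> pverts T. x \<in> X t \<and> y \<in> X t) \<and>
     (\<forall>t1 t2 t3 c. pre_digraph.apath (with_proj T) t1 c t3 \<and> t2 \<in> set (pawalk_verts t1 c) \<longrightarrow>
        X t1 \<inter> X t3 \<subseteq> X t2)"

text \<open>Widths are integers, since the empty graph has width \<open>-1\<close>.\<close>

definition treewidth :: "'a pair_pre_digraph \<Rightarrow> int" where
  "treewidth G = (LEAST k. \<exists>T X. tree_decomposition G T X \<and>
     k = int (Max ((\<lambda>t. card (X t)) ` pverts T)) - 1)"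

definition complemented_treewidth :: "'a pair_pre_digraph \<Rightarrow> int" where
  "complemented_treewidth G = treewidth (complement G)"

text \<open>
  The vertex maps are extensional, so that arrows are equal if and only if they have the same
  domain and codomain and agree on the vertices of the domain.
\<close>

definition Gr_bar ::
    "(nat pair_pre_digraph, nat pair_pre_digraph \<times> (nat \<Rightarrow> nat) \<times> nat pair_pre_digraph) cat" where
  "Gr_bar = \<lparr>
     Ob = graphs,
     Ar = {(G, f, H). G \<in> graphs \<and> H \<in> graphs \<and> f \<in> pverts G \<rightarrow>\<^sub>E pverts H \<and>
            (\<forall>x \<in> pverts G. \<forall>y \<in> pverts G. (f x, f y) \<in> parcs H \<longrightarrow> (x, y) \<in> parcs G)},
     Dom = (\<lambda>(G, f, H). G),
     Cod = (\<lambda>(G, f, H). H),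
     Id = (\<lambda>G. (G, restrict (\<lambda>x. x) (pverts G), G)),
     Comp = (\<lambda>(H', g, K) (G, f, H). (G, compose (pverts G) g f, K))\<rparr>"


section \<open>Structured decompositions\<close>

datatype 'a el_ob = Vertex 'a | Edge "'a set"
datatype 'a el_ar = Ident "'a el_ob" | Incl "'a set" 'a

definition edges :: "'a pair_pre_digraph \<Rightarrow> 'a set set" where
  "edges G = {{x, y} | x y. (x, y) \<in> parcs G}"

text \<open>
  The category \<open>\<integral>G\<close>. If two arrows are composable, at least one of them is an identity.
\<close>

definition elements :: "'a pair_pre_digraph \<Rightarrow> ('a el_ob, 'a el_ar) cat" where
  "elements G = \<lparr>
     Ob = Vertex ` pverts G \<union> Edge ` edges G,
     Ar = Ident ` (Vertex ` pverts G \<union> Edge ` edges G) \<union> {Incl e x | e x. e \<in> edges G \<and> x \<in> e},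
     Dom = (\<lambda>u. case u of Ident i \<Rightarrow> i | Incl e x \<Rightarrow> Edge e),
     Cod = (\<lambda>u. case u of Ident i \<Rightarrow> i | Incl e x \<Rightarrow> Vertex x),
     Id = Ident,
     Comp = (\<lambda>v u. case u of Ident i \<Rightarrow> v | Incl e x \<Rightarrow> u)\<rparr>"

type_synonym ('o, 'm) decomp = "(nat el_ob, nat el_ar, 'o, 'm) diagram"

definition structured_decomposition ::
    "('o, 'm) cat \<Rightarrow> nat pair_pre_digraph set \<Rightarrow> nat pair_pre_digraph \<Rightarrow> ('o, 'm) decomp \<Rightarrow> bool" where
  "structured_decomposition C \<G> G d \<longleftrightarrow>
     G \<in> \<G> \<and> is_functor (elements G) C d \<and> (\<forall>u \<in> Ar (elements G). monic C (farr d u))"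

definition decomposition_of ::
    "('o, 'm) cat \<Rightarrow> nat pair_pre_digraph set \<Rightarrow> nat pair_pre_digraph \<Rightarrow> ('o, 'm) decomp \<Rightarrow> 'o \<Rightarrow> bool"
  where
  "decomposition_of C \<G> G d X \<longleftrightarrow>
     structured_decomposition C \<G> G d \<and>
     (\<exists>L \<iota>. is_colimit (elements G) C d L \<iota> \<and> isomorphic C X L)"


section \<open>Spined sd-categories and width categories\<close>

text \<open>
  A full subcategory is given by its set of objects; \<open>\<Omega> n\<close> is the \<open>n\<close>-th stage of the filtration
  of the spine \<open>\<Union>n. \<Omega> n\<close>.
\<close>

locale spined_sd_category = category C
  for C :: "('o, 'm) cat" (structure) +
  fixes \<G> :: "nat pair_pre_digraph set"
    and \<Omega> :: "nat \<Rightarrow> 'o set"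
  assumes shapes_graphs: "\<G> \<subseteq> graphs"
    and one_vertex_graph: "Disc 1 \<in> \<G>"
    and W1: "structured_decomposition C \<G> G d \<Longrightarrow> \<exists>L \<iota>. is_colimit (elements G) C d L \<iota>"
    and spine_Ob: "\<Omega> n \<subseteq> Ob C"
    and spine_filtered: "\<Omega> n \<subseteq> \<Omega> (Suc n)"
    and spine_iso: "\<lbrakk>X \<in> \<Omega> n; Y \<in> Ob C; isomorphic C X Y\<rbrakk> \<Longrightarrow> Y \<in> \<Omega> n"
    and W2a: "X \<in> Ob C \<Longrightarrow> \<exists>W \<in> (\<Union>n. \<Omega> n). \<exists>f \<in> hom_set C X W. monic C f"
    and W2b: "\<lbrakk>n \<ge> 1; W \<in> \<Omega> n - \<Omega> (n - 1)\<rbrakk>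
          \<Longrightarrow> \<not> (\<exists>W' \<in> \<Omega> (n - 1). \<exists>f \<in> hom_set C W W'. monic C f)"

locale width_category = spined_sd_category +
  assumes pullbacks: "\<lbrakk>monic C f; g \<in> Ar C; Cod C f = Cod C g\<rbrakk> \<Longrightarrow> \<exists>P p q. is_pullback C f g P p q"
    and W3: "\<lbrakk>structured_decomposition C \<G> G d; is_colimit (elements G) C d Y \<iota>;
           monic C f; f \<in> hom_set C X Y\<rbrakk>
          \<Longrightarrow> \<exists>d' p q. is_pullback_cocone (elements G) C d \<iota> f d' p q \<and>
                is_colimit (elements G) C d' X p"

definition spine_size :: "('o, 'm) cat \<Rightarrow> (nat \<Rightarrow> 'o set) \<Rightarrow> 'o \<Rightarrow> nat" where
  "spine_size C \<Omega> X = (LEAST n. \<exists>W \<in> \<Omega> n. \<exists>f \<in> hom_set C X W. monic C f)"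

definition decomposition_width ::
    "('o, 'm) cat \<Rightarrow> (nat \<Rightarrow> 'o set) \<Rightarrow> nat pair_pre_digraph \<Rightarrow> ('o, 'm) decomp \<Rightarrow> int" where
  "decomposition_width C \<Omega> G d =
     int (Max ((\<lambda>x. spine_size C \<Omega> (fobj d (Vertex x))) ` pverts G)) - 1"

definition width ::
    "('o, 'm) cat \<Rightarrow> nat pair_pre_digraph set \<Rightarrow> (nat \<Rightarrow> 'o set) \<Rightarrow> 'o \<Rightarrow> int" where
  "width C \<G> \<Omega> X =
     (LEAST k. \<exists>G d. decomposition_of C \<G> G d X \<and> k = decomposition_width C \<Omega> G d)"

definition Disc_spine :: "nat \<Rightarrow> nat pair_pre_digraph set" where
  "Disc_spine n = {X \<in> Ob Gr_bar. \<exists>m \<le> n. isomorphic Gr_bar X (Disc m)}"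

end

theory Submission
  imports Defs
begin

text \<open>
  Passing to complements, an arrow preserves the reflexive relation ``equal or not adjacent''.
  Hence the monomorphisms are the injective arrows, and the colimit of a diagram is the colimit of
  the vertex sets in which two vertices are related exactly when they are related in some bag.
  This description is stable under pullback, which gives the width category. A monomorphism
  \<open>G \<rightarrow> Disc n\<close> exists if and only if \<open>G\<close> has at most \<open>n\<close> vertices, so the width of a
  decomposition is the size of its largest bag minus one.

  A tree decomposition of the complement of \<open>G\<close> yields the diagram of the induced subgraphs on the
  bags and on their intersections along edges, whose colimit is \<open>G\<close>. Conversely, the images of the
  bags of a colimit cocone form a tree decomposition: two bags that contain \<open>x\<close> are connected by a
  walk through bags that contain \<open>x\<close>, and in a tree this walk visits the whole path between them.
\<close>

section \<open>Paths in trees\<close>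

text \<open>Decompositions are defined through arbitrary colimits, so an explicit description of a
  single colimit is not enough. One cocone of the described form is built and compared with the
  given colimit through the isomorphism between them; pullbacks are read off from their universal
  property. Objects have initial segments of the naturals as vertex sets, so subsets, pairs and
  equivalence classes all have to be enumerated by bijections. The shape matters in two opposite
  ways. Connectedness of the tree supplies the path along which the copies of a vertex in two bags
  are identified in the colimit. Conversely, the colimit only says that two copies are linked by
  some walk in the shape, and acyclicity is what makes this a statement about the path between the
  two bags: on a cyclic shape the linking walk could go round the other side and miss bags on the
  given path.\<close>

text \<open>Induction on the length of the path. If it meets \<open>W\<close> in an interior vertex,
  split it there. Otherwise its interior avoids \<open>W\<close>, and if the interior is nonempty,
  returning from \<open>v\<close> to \<open>u\<close> inside \<open>W\<close> closes the path to a
  cycle of length at least 3.\<close>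

lemma (in pair_graph) apath_verts_subset:
  assumes short: "\<And>c. cycle c \<Longrightarrow> length c < 3"
    and conn: "\<And>u v. u \<in> W \<Longrightarrow> v \<in> W \<Longrightarrow> \<exists>p. awalk u p v \<and> set (pawalk_verts u p) \<subseteq> W"
  shows "apath u c v \<Longrightarrow> u \<in> W \<Longrightarrow> v \<in> W \<Longrightarrow> set (pawalk_verts u c) \<subseteq> W"
proof (induction "length c" arbitrary: u c v rule: less_induct)
  case less
  have aw: "awalk u c v" and dist: "distinct (pawalk_verts u c)"
    using less.prems(1) by (auto simp: apath_def)
  show ?case
  proof (cases "\<exists>w \<in> set (pawalk_verts u c). w \<in> W \<and> w \<noteq> u \<and> w \<noteq> v")
    case True
    then obtain w where w: "w \<in> set (pawalk_verts u c)" "w \<in> W" "w \<noteq> u" "w \<noteq> v" by blast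
    obtain q r where qr: "c = q @ r" "awalk u q w" "awalk w r v"
      using awalk_decomp[OF aw w(1)] by blast
    have ne: "q \<noteq> []" "r \<noteq> []" using qr w(3,4) by (auto simp: awalk_Nil_iff)
    have "apath u q w" "apath w r v"
      using less.prems(1) qr by (auto simp: apath_append_iff)
    then have "set (pawalk_verts u q) \<subseteq> W" "set (pawalk_verts w r) \<subseteq> W"
      using less.hyps ne qr(1) w(2) less.prems(2,3) by auto
    then show ?thesis using set_awalk_verts_append[OF qr(2,3)] qr(1) by simp
  next
    case False
    show ?thesis
    proof (rule ccontr)
      assume "\<not> ?thesis"
      then obtain w where w: "w \<in> set (pawalk_verts u c)" "w \<notin> W" by blast
      have uv: "u \<noteq> v"
      proof
        assume "u = v"
        then have "c = []" using less.prems(1) apath_nonempty_ends by blast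
        then show False using w less.prems(2) by simp
      qed
      \<comment> \<open>A path with at most one arc has no vertices besides its ends, and these lie
        in \<open>W\<close>.\<close>
      have len: "length c \<ge> 2"
      proof (rule ccontr)
        assume "\<not> length c \<ge> 2"
        then consider "c = []" | e where "c = [e]"
          by (metis One_nat_def Suc_1 Suc_le_eq length_0_conv length_Suc_conv less_Suc_eq
              not_less_eq_eq not_less_zero nat_neq_iff)
        then show False
          using w less.prems aw by cases (auto simp: awalk_simps)
      qed
      obtain p0 where p0: "awalk v p0 u" "set (pawalk_verts v p0) \<subseteq> W"
        using conn less.prems by blast
      define p where "p = awalk_to_apath p0"
      have p: "apath v p u" unfolding p_def by (rule apath_awalk_to_apath[OF p0(1)])
      have pne: "p \<noteq> []" using p uv by (auto simp: apath_Nil_iff)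
      \<comment> \<open>Shortening a walk to a path only drops arcs, so the return path stays inside
        \<open>W\<close>.\<close>
      have "set p \<subseteq> set p0" unfolding p_def by (rule awalk_to_apath_subset[OF p0(1)])
      moreover have pa: "awalk v p u" using p by (simp add: apath_def)
      ultimately have "set (pawalk_verts v p) \<subseteq> set (pawalk_verts v p0)"
        unfolding set_awalk_verts[OF pa] set_awalk_verts[OF p0(1)] set_map
        by (intro Un_mono image_mono subset_refl)
      with p0(2) have pW: "set (pawalk_verts v p) \<subseteq> W" by (rule subset_trans[rotated])
      have cyc: "awalk u (c @ p) u" using aw pa by (rule awalk_appendI)
      have "pawalk_verts u (c @ p) = pawalk_verts u c @ tl (pawalk_verts v p)"
        using awalk_verts_append[OF cyc] aw by simp
      moreover obtain us where us: "pawalk_verts u c = u # us"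
        using aw by (cases c) (auto simp: awalk_simps)
      moreover obtain vs where vs: "pawalk_verts v p = v # vs"
        using pa by (cases p) (auto simp: awalk_simps)
      ultimately have verts: "tl (pawalk_verts u (c @ p)) = us @ vs" by simp
      have "distinct (v # vs)" "distinct (u # us)"
        using p dist vs us by (auto simp: apath_def)
      \<comment> \<open>A common vertex lies on \<open>c\<close> and in \<open>W\<close>, so it is
        \<open>u\<close> or \<open>v\<close>; but \<open>u\<close> is not in \<open>us\<close>, and
        \<open>v\<close> is not in \<open>vs\<close>.\<close>
      moreover have "set us \<inter> set vs = {}"
        using False pW us vs calculation by auto
      ultimately have "cycle (c @ p)"
        unfolding cycle_def using cyc verts pne by auto
      \<comment> \<open>Cycles of length 2, made of two opposite arcs, are permitted. Here
        \<open>c\<close> has at least 2 arcs and \<open>p\<close> at least 1, which just exceeds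
        that.\<close>
      then have "length (c @ p) < 3" by (rule short)
      moreover have "length p \<ge> 1" using pne by (cases p) auto
      ultimately show False using len by simp
    qed
  qed
qed

text \<open>Applied later to the set \<open>W\<close> of tree vertices whose bags contain a given
  vertex. Such a set is not known to be connected in advance, so \<open>apath_verts_subset\<close>
  is used for \<open>W'\<close>, the component of \<open>s\<close> in \<open>W\<close>.\<close>

lemma (in pair_graph) apath_verts_in_reachable:
  assumes short: "\<And>c. cycle c \<Longrightarrow> length c < 3"
    and reach: "(s, t) \<in> (parcs G \<inter> W \<times> W)\<^sup>*"
    and path: "apath s c t"
    and s: "s \<in> W"
  shows "set (pawalk_verts s c) \<subseteq> W"
proof -
  define W' where "W' = {t. (s, t) \<in> (parcs G \<inter> W \<times> W)\<^sup>*}"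
  have sG: "s \<in> pverts G" using path by (auto simp: apath_def)
  have "W' \<subseteq> W"
    unfolding W'_def using s by (auto elim: rtranclE)
  \<comment> \<open>Walks in both directions are carried along, so that any two vertices of
    \<open>W'\<close> can be joined through \<open>s\<close> without reversing a walk.\<close>
  have both: "(\<exists>p. awalk s p t \<and> set (pawalk_verts s p) \<subseteq> W') \<and>
      (\<exists>p. awalk t p s \<and> set (pawalk_verts t p) \<subseteq> W')"
    if "(s, t) \<in> (parcs G \<inter> W \<times> W)\<^sup>*" for t
    using that
  proof (induction rule: rtrancl_induct)
    case base
    have "awalk s [] s" using sG by (simp add: awalk_Nil_iff)
    moreover have "set (pawalk_verts s []) \<subseteq> W'" by (simp add: W'_def)
    ultimately show ?case by blast
  next
    case (step t t')
    obtain p q where p: "awalk s p t" "set (pawalk_verts s p) \<subseteq> W'"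
      and q: "awalk t q s" "set (pawalk_verts t q) \<subseteq> W'" using step.IH by blast
    have arc: "(t, t') \<in> parcs G" "(t', t) \<in> parcs G"
      using step.hyps(2) arcs_symmetric by auto
    have t: "t \<in> W'" "t' \<in> W'"
      using step.hyps rtrancl_into_rtrancl[OF step.hyps] unfolding W'_def by simp_all
    have 1: "awalk t [(t, t')] t'" using arc(1) by (auto simp: awalk_simps intro: in_arcsD2)
    have "awalk s (p @ [(t, t')]) t'" using p(1) 1 by (rule awalk_appendI)
    moreover have "set (pawalk_verts s (p @ [(t, t')])) \<subseteq> W'"
      using set_awalk_verts_append[OF p(1) 1] p(2) t by simp
    moreover have "awalk t' ((t', t) # q) s" using q(1) arc(2) by (simp add: awalk_simps)
    moreover have "set (pawalk_verts t' ((t', t) # q)) \<subseteq> W'" using q(2) t by simp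
    ultimately show ?case by blast
  qed
  have "set (pawalk_verts s c) \<subseteq> W'"
  proof (rule apath_verts_subset[OF short _ path])
    fix u v assume "u \<in> W'" "v \<in> W'"
    then have "(s, u) \<in> (parcs G \<inter> W \<times> W)\<^sup>*" "(s, v) \<in> (parcs G \<inter> W \<times> W)\<^sup>*"
      by (simp_all add: W'_def)
    from both[OF this(1)] both[OF this(2)] obtain p q where p: "awalk u p s" "set (pawalk_verts u p) \<subseteq> W'"
      and q: "awalk s q v" "set (pawalk_verts s q) \<subseteq> W'" by blast
    then show "\<exists>p. awalk u p v \<and> set (pawalk_verts u p) \<subseteq> W'"
      using awalk_appendI[OF p(1) q(1)] set_awalk_verts_append[OF p(1) q(1)]
      by (intro exI[of _ "p @ q"]) simp
  qed (use reach in \<open>auto simp: W'_def\<close>)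
  with \<open>W' \<subseteq> W\<close> show ?thesis by blast
qed

section \<open>Trees as shapes\<close>

lemma Trees_pair_graph: "T \<in> Trees \<Longrightarrow> pair_graph T"
  by (simp add: Trees_def graphs_def)

lemma Trees_no_cycle: "T \<in> Trees \<Longrightarrow> pre_digraph.cycle (with_proj T) c \<Longrightarrow> length c < 3"
  by (force simp: Trees_def)

lemma Trees_nonempty: "T \<in> Trees \<Longrightarrow> pverts T \<noteq> {}"
  by (auto simp: Trees_def Digraph_Component.connected_def strongly_connected_def mk_symmetric_def)

lemma Trees_apath:
  assumes T: "T \<in> Trees" and st: "s \<in> pverts T" "t \<in> pverts T"
  shows "\<exists>c. pre_digraph.apath (with_proj T) s c t"
proof -
  interpret pair_graph T using T by (rule Trees_pair_graph)
  have "Digraph_Component.connected (with_proj T)" using T by (simp add: Trees_def)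
  moreover have "symmetric (with_proj T)" using pair_sym_arcs .
  ultimately have "strongly_connected (with_proj T)"
    by (rule symmetric_connected_imp_strongly_connected[rotated])
  then have "s \<rightarrow>\<^sup>*\<^bsub>with_proj T\<^esub> t" using st by (auto simp: strongly_connected_def)
  then show ?thesis by (simp add: reachable_apath)
qed

section \<open>Categories\<close>

lemma hom_setD:
  assumes "f \<in> hom_set C X Y"
  shows "f \<in> Ar C" "Dom C f = X" "Cod C f = Y"
  using assms by (auto simp: hom_set_def)

context category
begin

lemma comp_hom:
  "f \<in> hom_set C X Y \<Longrightarrow> g \<in> hom_set C Y Z \<Longrightarrow> g \<odot> f \<in> hom_set C X Z"
  by (auto simp: hom_set_def Comp_in Dom_Comp Cod_Comp)

lemma comp_assoc:
  "f \<in> hom_set C X Y \<Longrightarrow> g \<in> hom_set C Y Z \<Longrightarrow> h \<in> hom_set C Z W \<Longrightarrow>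
    (h \<odot> g) \<odot> f = h \<odot> (g \<odot> f)"
  by (auto simp: hom_set_def Comp_assoc)

lemma id_hom: "X \<in> Ob C \<Longrightarrow> Id C X \<in> hom_set C X X"
  by (simp add: hom_set_def Id_in Dom_Id Cod_Id)

lemma comp_id: "f \<in> hom_set C X Y \<Longrightarrow> f \<odot> Id C X = f"
  by (auto simp: hom_set_def Comp_Id)

lemma id_comp: "f \<in> hom_set C X Y \<Longrightarrow> Id C Y \<odot> f = f"
  by (auto simp: hom_set_def Id_Comp)

lemma hom_Ob: "f \<in> hom_set C X Y \<Longrightarrow> X \<in> Ob C" "f \<in> hom_set C X Y \<Longrightarrow> Y \<in> Ob C"
  by (auto simp: hom_set_def Dom_in Cod_in)

lemma cocone_comp:
  assumes "is_functor J C d" "category J" "is_cocone J C d X \<iota>" "g \<in> hom_set C X Y"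
  shows "is_cocone J C d Y (\<lambda>i. g \<odot> \<iota> i)"
proof -
  interpret J: category J by fact
  show ?thesis
    using assms(1,3) comp_hom[OF _ assms(4)] hom_Ob(2)[OF assms(4)]
      comp_assoc[OF _ _ assms(4)] J.Dom_in J.Cod_in
    unfolding is_cocone_def is_functor_def by metis
qed

lemma colimit_unique:
  assumes X: "is_colimit J C d X \<iota>" and Y: "is_colimit J C d Y \<kappa>"
  obtains u v where "u \<in> hom_set C X Y" "v \<in> hom_set C Y X" "v \<odot> u = Id C X" "u \<odot> v = Id C Y"
    "\<And>i. i \<in> Ob J \<Longrightarrow> u \<odot> \<iota> i = \<kappa> i" "\<And>i. i \<in> Ob J \<Longrightarrow> v \<odot> \<kappa> i = \<iota> i"
proof -
  \<comment> \<open>Uniqueness in the universal property of \<open>X\<close>, applied to its own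
    legs. The claim is generic in the two colimits because it is used once in each
    direction.\<close>
  have *: "v \<odot> u = Id C X"
    if X: "is_colimit J C d X \<iota>"
      and u: "u \<in> hom_set C X Y" "\<And>i. i \<in> Ob J \<Longrightarrow> u \<odot> \<iota> i = \<kappa> i"
      and v: "v \<in> hom_set C Y X" "\<And>i. i \<in> Ob J \<Longrightarrow> v \<odot> \<kappa> i = \<iota> i" for X Y \<iota> \<kappa> u v
  proof -
    have c: "is_cocone J C d X \<iota>" using X by (simp add: is_colimit_def)
    have \<iota>: "\<iota> i \<in> hom_set C (fobj d i) X" if "i \<in> Ob J" for i
      using c that by (simp add: is_cocone_def)
    have "\<exists>!w. w \<in> hom_set C X X \<and> (\<forall>i \<in> Ob J. w \<odot> \<iota> i = \<iota> i)"
      using X c unfolding is_colimit_def by blast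
    moreover have "v \<odot> u \<in> hom_set C X X" using comp_hom u v by blast
    moreover have "(v \<odot> u) \<odot> \<iota> i = \<iota> i" if "i \<in> Ob J" for i
      using comp_assoc[OF \<iota>[OF that] u(1) v(1)] u(2) v(2) that by simp
    moreover have "Id C X \<in> hom_set C X X" using id_hom hom_Ob u(1) by blast
    moreover have "Id C X \<odot> \<iota> i = \<iota> i" if "i \<in> Ob J" for i
      using id_comp \<iota> that by blast
    ultimately show ?thesis by blast
  qed
  obtain u where u: "u \<in> hom_set C X Y" "\<And>i. i \<in> Ob J \<Longrightarrow> u \<odot> \<iota> i = \<kappa> i"
    using X Y unfolding is_colimit_def by meson
  obtain v where v: "v \<in> hom_set C Y X" "\<And>i. i \<in> Ob J \<Longrightarrow> v \<odot> \<kappa> i = \<iota> i"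
    using X Y unfolding is_colimit_def by meson
  show thesis using that[OF u(1) v(1) *[OF X u v] *[OF Y v u] u(2) v(2)] .
qed

text \<open>A decomposition of \<open>X\<close> only provides a colimit isomorphic to
  \<open>X\<close>. This moves the cocone to \<open>X\<close> itself, so that the images of its legs
  become sets of vertices of \<open>X\<close>.\<close>

lemma colimit_iso:
  assumes F: "is_functor J C d" "category J"
    and L: "is_colimit J C d L \<iota>"
    and u: "u \<in> hom_set C L X" and v: "v \<in> hom_set C X L"
    and vu: "v \<odot> u = Id C L" and uv: "u \<odot> v = Id C X"
  shows "is_colimit J C d X (\<lambda>i. u \<odot> \<iota> i)"
  unfolding is_colimit_def
proof (intro conjI allI impI)
  have c: "is_cocone J C d L \<iota>" using L by (simp add: is_colimit_def)
  then have \<iota>: "\<iota> i \<in> hom_set C (fobj d i) L" if "i \<in> Ob J" for i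
    using that by (simp add: is_cocone_def)
  show "is_cocone J C d X (\<lambda>i. u \<odot> \<iota> i)" using cocone_comp[OF F c u] .
  fix Y \<kappa> assume "is_cocone J C d Y \<kappa>"
  then have ex: "\<exists>!w. w \<in> hom_set C L Y \<and> (\<forall>i \<in> Ob J. w \<odot> \<iota> i = \<kappa> i)"
    using L unfolding is_colimit_def by blast
  then obtain w where w: "w \<in> hom_set C L Y" "\<And>i. i \<in> Ob J \<Longrightarrow> w \<odot> \<iota> i = \<kappa> i" by blast
  show "\<exists>!w. w \<in> hom_set C X Y \<and> (\<forall>i \<in> Ob J. w \<odot> (u \<odot> \<iota> i) = \<kappa> i)"
  proof (rule ex1I[of _ "w \<odot> v"], intro conjI ballI)
    show wv: "w \<odot> v \<in> hom_set C X Y" using comp_hom[OF v w(1)] .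
    fix i assume i: "i \<in> Ob J"
    have "(w \<odot> v) \<odot> (u \<odot> \<iota> i) = w \<odot> (v \<odot> (u \<odot> \<iota> i))"
      using comp_assoc[OF comp_hom[OF \<iota>[OF i] u] v w(1)] .
    also have "v \<odot> (u \<odot> \<iota> i) = \<iota> i"
      using comp_assoc[OF \<iota>[OF i] u v] vu id_comp[OF \<iota>[OF i]] by simp
    finally show "(w \<odot> v) \<odot> (u \<odot> \<iota> i) = \<kappa> i" using w(2)[OF i] by simp
  next
    fix w' assume w': "w' \<in> hom_set C X Y \<and> (\<forall>i \<in> Ob J. w' \<odot> (u \<odot> \<iota> i) = \<kappa> i)"
    have "(w' \<odot> u) \<odot> \<iota> i = \<kappa> i" if "i \<in> Ob J" for i
      using comp_assoc[OF \<iota>[OF that] u] w' that by metis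
    moreover have "w' \<odot> u \<in> hom_set C L Y" using comp_hom[OF u] w' by blast
    ultimately have "w = w' \<odot> u" using ex w by blast
    then have "w \<odot> v = w' \<odot> (u \<odot> v)" using comp_assoc[OF v u] w' by metis
    then show "w' = w \<odot> v" using uv comp_id w' by metis
  qed
qed

text \<open>The pullbacks are chosen object by object; their universal property induces the arrows
  between them, and uniqueness makes the choice functorial.\<close>

lemma pullback_cocone_exists:
  assumes J: "category J" and d: "is_functor J C d" and \<iota>: "is_cocone J C d Y \<iota>"
    and f: "f \<in> hom_set C X Y"
    and pb: "\<And>i. i \<in> Ob J \<Longrightarrow> \<exists>P p q. is_pullback C f (\<iota> i) P p q"
  shows "\<exists>d' p q. is_pullback_cocone J C d \<iota> f d' p q"
proof -
  interpret J: category J by fact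
  obtain P p q where P: "\<And>i. i \<in> Ob J \<Longrightarrow> is_pullback C f (\<iota> i) (P i) (p i) (q i)"
    using pb by metis
  have \<iota>h: "\<iota> i \<in> hom_set C (fobj d i) Y" if "i \<in> Ob J" for i
    using \<iota> that by (simp add: is_cocone_def)
  have \<iota>n: "\<iota> (Cod J u) \<odot> farr d u = \<iota> (Dom J u)" if "u \<in> Ar J" for u
    using \<iota> that by (simp add: is_cocone_def)
  have dh: "farr d u \<in> hom_set C (fobj d (Dom J u)) (fobj d (Cod J u))" if "u \<in> Ar J" for u
    using d that by (simp add: is_functor_def)
  have PO: "P i \<in> Ob C" and ph: "p i \<in> hom_set C (P i) X" and qh: "q i \<in> hom_set C (P i) (fobj d i)"
    and comm: "f \<odot> p i = \<iota> i \<odot> q i" if "i \<in> Ob J" for i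
    using P[OF that] f \<iota>h[OF that] by (auto simp: is_pullback_def hom_setD)
  have univ: "\<exists>!w. w \<in> hom_set C Q (P i) \<and> p i \<odot> w = a \<and> q i \<odot> w = b"
    if "i \<in> Ob J" "a \<in> hom_set C Q X" "b \<in> hom_set C Q (fobj d i)" "f \<odot> a = \<iota> i \<odot> b" for i Q a b
    using P[OF that(1)] that f \<iota>h[OF that(1)] hom_Ob(1)[OF that(2)]
    by (simp add: is_pullback_def hom_setD)
  \<comment> \<open>The arrow between the chosen pullbacks that \<open>u\<close> induces. Identities
    and composites satisfy the same equations, whence functoriality.\<close>
  define F where "F u w \<longleftrightarrow> w \<in> hom_set C (P (Dom J u)) (P (Cod J u)) \<and>
    p (Cod J u) \<odot> w = p (Dom J u) \<and> q (Cod J u) \<odot> w = farr d u \<odot> q (Dom J u)" for u w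
  have F: "\<exists>!w. F u w" if u: "u \<in> Ar J" for u
    unfolding F_def
  proof (rule univ)
    show "Cod J u \<in> Ob J" "p (Dom J u) \<in> hom_set C (P (Dom J u)) X"
      "farr d u \<odot> q (Dom J u) \<in> hom_set C (P (Dom J u)) (fobj d (Cod J u))"
      using J.Cod_in[OF u] ph[OF J.Dom_in[OF u]] comp_hom[OF qh[OF J.Dom_in[OF u]] dh[OF u]] by auto
    show "f \<odot> p (Dom J u) = \<iota> (Cod J u) \<odot> (farr d u \<odot> q (Dom J u))"
      using comm[OF J.Dom_in[OF u]] \<iota>n[OF u]
        comp_assoc[OF qh[OF J.Dom_in[OF u]] dh[OF u] \<iota>h[OF J.Cod_in[OF u]]] by simp
  qed
  define d' where
    "d' = \<lparr>fobj = P, farr = (\<lambda>u. THE w. F u w)\<rparr>"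
  have Fd: "F u (farr d' u)" if "u \<in> Ar J" for u
    unfolding d'_def using theI'[OF F[OF that]] by simp
  have Fh: "farr d' u \<in> hom_set C (P (Dom J u)) (P (Cod J u))"
    and Fp: "p (Cod J u) \<odot> farr d' u = p (Dom J u)"
    and Fq: "q (Cod J u) \<odot> farr d' u = farr d u \<odot> q (Dom J u)" if "u \<in> Ar J" for u
    using Fd[OF that] by (simp_all add: F_def)
  have Fu: "farr d' u = w" if "u \<in> Ar J" "F u w" for u w
    using F[OF that(1)] Fd that by blast
  have fo: "fobj d' = P" by (simp add: d'_def)
  have "is_functor J C d'"
    unfolding is_functor_def fo
  proof (intro conjI ballI impI)
    fix i assume i: "i \<in> Ob J" then show "P i \<in> Ob C" by (rule PO)
    have "farr d (Id J i) = Id C (fobj d i)" using d i by (simp add: is_functor_def)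
    then have "F (Id J i) (Id C (P i))"
      unfolding F_def using i id_hom[OF PO] comp_id[OF ph] comp_id[OF qh] id_comp[OF qh]
      by (simp add: J.Dom_Id J.Cod_Id)
    then show "farr d' (Id J i) = Id C (P i)" using Fu J.Id_in[OF i] by blast
  next
    fix u assume "u \<in> Ar J"
    then show "farr d' u \<in> hom_set C (P (Dom J u)) (P (Cod J u))" by (rule Fh)
  next
    fix u v assume u: "u \<in> Ar J" and v: "v \<in> Ar J" and uv: "Cod J u = Dom J v"
    have vu: "v \<odot>\<^bsub>J\<^esub> u \<in> Ar J" using u v uv by (rule J.Comp_in)
    have Dv: "Dom J (v \<odot>\<^bsub>J\<^esub> u) = Dom J u" "Cod J (v \<odot>\<^bsub>J\<^esub> u) = Cod J v"
      using u v uv J.Dom_Comp J.Cod_Comp by auto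
    have Ob: "Dom J u \<in> Ob J" "Dom J v \<in> Ob J" "Cod J v \<in> Ob J" using u v J.Dom_in J.Cod_in by auto
    let ?u = "farr d' u" and ?v = "farr d' v"
    have fu: "?u \<in> hom_set C (P (Dom J u)) (P (Dom J v))" "p (Dom J v) \<odot> ?u = p (Dom J u)"
      "q (Dom J v) \<odot> ?u = farr d u \<odot> q (Dom J u)"
      using Fh[OF u] Fp[OF u] Fq[OF u] uv by simp_all
    have fv: "?v \<in> hom_set C (P (Dom J v)) (P (Cod J v))" "p (Cod J v) \<odot> ?v = p (Dom J v)"
      "q (Cod J v) \<odot> ?v = farr d v \<odot> q (Dom J v)"
      using Fh[OF v] Fp[OF v] Fq[OF v] by simp_all
    have du: "farr d u \<in> hom_set C (fobj d (Dom J u)) (fobj d (Dom J v))" using dh[OF u] uv by simp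
    have dvu: "farr d (v \<odot>\<^bsub>J\<^esub> u) = farr d v \<odot> farr d u" using d u v uv by (simp add: is_functor_def)
    have "p (Cod J v) \<odot> (?v \<odot> ?u) = p (Dom J u)"
      using comp_assoc[OF fu(1) fv(1) ph[OF Ob(3)]] fu(2) fv(2) by simp
    moreover have "q (Cod J v) \<odot> (?v \<odot> ?u) = farr d (v \<odot>\<^bsub>J\<^esub> u) \<odot> q (Dom J u)"
    proof -
      have "q (Cod J v) \<odot> (?v \<odot> ?u) = (farr d v \<odot> q (Dom J v)) \<odot> ?u"
        using comp_assoc[OF fu(1) fv(1) qh[OF Ob(3)]] fv(3) by simp
      also have "\<dots> = farr d v \<odot> (farr d u \<odot> q (Dom J u))"
        using comp_assoc[OF fu(1) qh[OF Ob(2)] dh[OF v]] fu(3) by simp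
      also have "\<dots> = farr d (v \<odot>\<^bsub>J\<^esub> u) \<odot> q (Dom J u)"
        using comp_assoc[OF qh[OF Ob(1)] du dh[OF v]] dvu by simp
      finally show ?thesis .
    qed
    ultimately have "F (v \<odot>\<^bsub>J\<^esub> u) (?v \<odot> ?u)"
      unfolding F_def Dv using comp_hom[OF fu(1) fv(1)] by simp
    then show "farr d' (v \<odot>\<^bsub>J\<^esub> u) = ?v \<odot> ?u" using Fu[OF vu] by blast
  qed
  then have "is_pullback_cocone J C d \<iota> f d' p q"
    unfolding is_pullback_cocone_def fo using P Fp Fq by simp
  then show ?thesis by blast
qed

end

section \<open>The category of elements as a finite indexing category\<close>

lemma elements_category:
  assumes "pair_graph G"
  shows "category (elements G)"
proof -
  interpret pair_graph G by fact
  have "x \<in> pverts G" if "e \<in> edges G" "x \<in> e" for e x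
    using that by (auto simp: edges_def dest: in_arcsD1 in_arcsD2)
  then show ?thesis
    by unfold_locales (auto simp: elements_def split: el_ar.splits)
qed

text \<open>Finiteness allows the vertices of a colimit to be numbered by an initial segment of the
  naturals.\<close>

lemma elements_finite:
  assumes "pair_graph T"
  shows "finite (Ob (elements T))"
proof -
  interpret pair_graph T by fact
  have "edges T = (\<lambda>(x, y). {x, y}) ` parcs T" by (auto simp: edges_def)
  then show ?thesis using pair_finite_verts pair_finite_arcs by (simp add: elements_def)
qed

section \<open>The category of graphs and reflexive homomorphisms\<close>

abbreviation vmap :: "'a \<times> ('b \<Rightarrow> 'c) \<times> 'd \<Rightarrow> 'b \<Rightarrow> 'c" where
  "vmap m \<equiv> fst (snd m)"

type_synonym gr_arr = "nat pair_pre_digraph \<times> (nat \<Rightarrow> nat) \<times> nat pair_pre_digraph"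

definition gr_map :: "nat pair_pre_digraph \<Rightarrow> (nat \<Rightarrow> nat) \<Rightarrow> nat pair_pre_digraph \<Rightarrow> gr_arr" where
  "gr_map G f H = (G, restrict f (pverts G), H)"

lemma vmap_gr_map [simp]: "x \<in> pverts G \<Longrightarrow> vmap (gr_map G f H) x = f x"
  by (simp add: gr_map_def)

lemma graphsI:
  assumes V: "pverts G = {..<n}"
    and A: "\<And>x y. (x, y) \<in> parcs G \<Longrightarrow> x < n \<and> y < n \<and> x \<noteq> y \<and> (y, x) \<in> parcs G"
  shows "G \<in> graphs"
proof -
  have "parcs G \<subseteq> {..<n} \<times> {..<n}" using A by auto
  then have "finite (parcs G)" by (rule finite_subset) simp
  then have "pair_graph G"
    using A V by unfold_locales (auto simp: symmetric_def intro!: symI)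
  then show ?thesis using V by (auto simp: graphs_def)
qed

lemma
  assumes "G \<in> graphs"
  shows graphs_finite: "finite (pverts G)"
    and graphs_irrefl: "(x, x) \<notin> parcs G"
    and graphs_sym: "(x, y) \<in> parcs G \<Longrightarrow> (y, x) \<in> parcs G"
    and graphs_verts: "(x, y) \<in> parcs G \<Longrightarrow> x \<in> pverts G \<and> y \<in> pverts G"
proof -
  interpret pair_graph G using assms by (simp add: graphs_def)
  show "finite (pverts G)" by (rule pair_finite_verts)
  show "(x, x) \<notin> parcs G" using pair_no_loops by fastforce
  show "(x, y) \<in> parcs G \<Longrightarrow> (y, x) \<in> parcs G" by (rule arcs_symmetric)
  show "(x, y) \<in> parcs G \<Longrightarrow> x \<in> pverts G \<and> y \<in> pverts G" by (blast dest: in_arcsD1 in_arcsD2)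
qed

lemma Disc_graphs: "Disc n \<in> graphs"
  by (rule graphsI[of _ n]) (auto simp: Disc_def)

lemma Gr_bar_hom_iff:
  "m \<in> hom_set Gr_bar G H \<longleftrightarrow> G \<in> graphs \<and> H \<in> graphs \<and>
    (\<exists>f. m = (G, f, H) \<and> f \<in> pverts G \<rightarrow>\<^sub>E pverts H \<and>
      (\<forall>x \<in> pverts G. \<forall>y \<in> pverts G. (f x, f y) \<in> parcs H \<longrightarrow> (x, y) \<in> parcs G))"
  by (auto simp: hom_set_def Gr_bar_def)

lemma gr_map_hom:
  assumes "G \<in> graphs" "H \<in> graphs"
    and "\<And>x. x \<in> pverts G \<Longrightarrow> f x \<in> pverts H"
    and "\<And>x y. x \<in> pverts G \<Longrightarrow> y \<in> pverts G \<Longrightarrow> (f x, f y) \<in> parcs H \<Longrightarrow> (x, y) \<in> parcs G"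
  shows "gr_map G f H \<in> hom_set Gr_bar G H"
  using assms by (auto simp: Gr_bar_hom_iff gr_map_def)

lemma
  assumes "m \<in> hom_set Gr_bar G H"
  shows Gr_bar_hom_graphs: "G \<in> graphs" "H \<in> graphs"
    and vmap_in: "x \<in> pverts G \<Longrightarrow> vmap m x \<in> pverts H"
    and vmap_edge: "x \<in> pverts G \<Longrightarrow> y \<in> pverts G \<Longrightarrow> (vmap m x, vmap m y) \<in> parcs H \<Longrightarrow>
      (x, y) \<in> parcs G"
  using assms by (auto simp: Gr_bar_hom_iff)

lemma Gr_bar_ext:
  assumes "m \<in> hom_set Gr_bar G H" "m' \<in> hom_set Gr_bar G H"
    and "\<And>x. x \<in> pverts G \<Longrightarrow> vmap m x = vmap m' x"
  shows "m = m'"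
proof -
  obtain f f' where "m = (G, f, H)" "f \<in> pverts G \<rightarrow>\<^sub>E pverts H"
    "m' = (G, f', H)" "f' \<in> pverts G \<rightarrow>\<^sub>E pverts H"
    using assms(1,2) unfolding Gr_bar_hom_iff by blast
  then show ?thesis using PiE_ext[of f "pverts G" "\<lambda>_. pverts H" f'] assms(3) by simp
qed

lemma vmap_comp [simp]:
  assumes "m \<in> hom_set Gr_bar G H" "x \<in> pverts G"
  shows "vmap (n \<odot>\<^bsub>Gr_bar\<^esub> m) x = vmap n (vmap m x)"
proof -
  obtain f where "m = (G, f, H)" using assms(1) unfolding Gr_bar_hom_iff by blast
  then show ?thesis using assms(2) by (cases n) (simp add: Gr_bar_def compose_def)
qed

lemma vmap_Id [simp]: "x \<in> pverts G \<Longrightarrow> vmap (Id Gr_bar G) x = x"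
  by (simp add: Gr_bar_def)

lemma Ob_Gr_bar [simp]: "Ob Gr_bar = graphs"
  by (simp add: Gr_bar_def)

lemma Gr_bar_category: "category Gr_bar"
proof
  fix f g h assume fgh: "f \<in> Ar Gr_bar" "g \<in> Ar Gr_bar" "h \<in> Ar Gr_bar"
    "Cod Gr_bar f = Dom Gr_bar g" "Cod Gr_bar g = Dom Gr_bar h"
  then obtain G f' H g' K h' L where "f = (G, f', H)" "g = (H, g', K)" "h = (K, h', L)"
    "f' \<in> pverts G \<rightarrow>\<^sub>E pverts H"
    by (auto simp: Gr_bar_def)
  then show "(h \<odot>\<^bsub>Gr_bar\<^esub> g) \<odot>\<^bsub>Gr_bar\<^esub> f = h \<odot>\<^bsub>Gr_bar\<^esub> (g \<odot>\<^bsub>Gr_bar\<^esub> f)"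
    by (auto simp: Gr_bar_def compose_def restrict_def fun_eq_iff)
qed (auto simp: Gr_bar_def compose_def PiE_def extensional_def Pi_iff restrict_def fun_eq_iff)

interpretation Gr: category Gr_bar by (rule Gr_bar_category)

text \<open>
  Arrows out of \<open>Disc 2\<close> see both the vertices and the non-adjacent pairs of a graph, so they
  suffice to read off its structure from universal properties.
\<close>

lemma pair_arrow:
  assumes G: "G \<in> graphs" and x: "x \<in> pverts G" and y: "y \<in> pverts G" and xy: "(x, y) \<notin> parcs G"
  obtains m where "m \<in> hom_set Gr_bar (Disc 2) G" "vmap m 0 = x" "vmap m 1 = y"
proof -
  let ?m = "gr_map (Disc 2) (\<lambda>i. if i = 0 then x else y) G"
  have "?m \<in> hom_set Gr_bar (Disc 2) G"
    using assms graphs_sym[OF G] graphs_irrefl[OF G]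
    by (intro gr_map_hom Disc_graphs) (auto split: if_splits)
  moreover have "vmap ?m 0 = x" "vmap ?m 1 = y" by (auto simp: Disc_def)
  ultimately show thesis by (rule that)
qed

lemma Disc_verts [simp]: "pverts (Disc n) = {..<n}" "parcs (Disc n) = {}"
  by (auto simp: Disc_def)

lemma pair_arrow_eqI:
  assumes "m \<in> hom_set Gr_bar (Disc 2) G" "m' \<in> hom_set Gr_bar (Disc 2) G"
    "vmap m 0 = vmap m' 0" "vmap m 1 = vmap m' 1"
  shows "m = m'"
  using assms(1,2)
proof (rule Gr_bar_ext)
  fix x assume "x \<in> pverts (Disc 2)"
  then have "x = 0 \<or> x = 1" by auto
  then show "vmap m x = vmap m' x" using assms(3,4) by auto
qed

text \<open>A vertex is a constant arrow out of \<open>Disc 2\<close>, which exists because no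
  vertex is adjacent to itself. Two vertices with the same image give two such arrows that agree
  after composition with \<open>m\<close>.\<close>

lemma monic_iff_inj:
  assumes m: "m \<in> hom_set Gr_bar G H"
  shows "monic Gr_bar m \<longleftrightarrow> inj_on (vmap m) (pverts G)"
proof
  assume mon: "monic Gr_bar m"
  have G: "G \<in> graphs" using Gr_bar_hom_graphs[OF m] by simp
  show "inj_on (vmap m) (pverts G)"
  proof (rule inj_onI)
    fix x y assume xy: "x \<in> pverts G" "y \<in> pverts G" "vmap m x = vmap m y"
    obtain g where g: "g \<in> hom_set Gr_bar (Disc 2) G" "vmap g 0 = x" "vmap g 1 = x"
      using pair_arrow[OF G xy(1,1) graphs_irrefl[OF G]] by blast
    obtain h where h: "h \<in> hom_set Gr_bar (Disc 2) G" "vmap h 0 = y" "vmap h 1 = y"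
      using pair_arrow[OF G xy(2,2) graphs_irrefl[OF G]] by blast
    have "m \<odot>\<^bsub>Gr_bar\<^esub> g = m \<odot>\<^bsub>Gr_bar\<^esub> h"
      by (rule pair_arrow_eqI[OF Gr.comp_hom[OF g(1) m] Gr.comp_hom[OF h(1) m]])
        (use g h xy in auto)
    then have "g = h"
      using mon g(1) h(1) Disc_graphs[of 2] unfolding monic_def hom_setD(2)[OF m] by auto
    then show "x = y" using g h by simp
  qed
next
  assume inj: "inj_on (vmap m) (pverts G)"
  show "monic Gr_bar m"
    unfolding monic_def hom_setD(2)[OF m]
  proof (intro conjI ballI impI)
    show "m \<in> Ar Gr_bar" using hom_setD(1)[OF m] .
    fix Z g h assume g: "g \<in> hom_set Gr_bar Z G" and h: "h \<in> hom_set Gr_bar Z G"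
      and eq: "m \<odot>\<^bsub>Gr_bar\<^esub> g = m \<odot>\<^bsub>Gr_bar\<^esub> h"
    show "g = h"
    proof (rule Gr_bar_ext[OF g h])
      fix x assume x: "x \<in> pverts Z"
      then have "vmap m (vmap g x) = vmap m (vmap h x)"
        using arg_cong[OF eq, of "\<lambda>k. vmap k x"] g h by simp
      then show "vmap g x = vmap h x" using inj_onD[OF inj] vmap_in[OF g x] vmap_in[OF h x] by blast
    qed
  qed
qed

section \<open>The spine\<close>

text \<open>\<open>Disc n\<close> has no edges for an arrow into it to reflect, so every map of
  vertices is an arrow and only injectivity restricts the size of \<open>G\<close>.\<close>

lemma monic_into_Disc_iff:
  assumes G: "G \<in> graphs"
  shows "(\<exists>f \<in> hom_set Gr_bar G (Disc n). monic Gr_bar f) \<longleftrightarrow> card (pverts G) \<le> n"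
proof
  assume "\<exists>f \<in> hom_set Gr_bar G (Disc n). monic Gr_bar f"
  then obtain f where f: "f \<in> hom_set Gr_bar G (Disc n)" "inj_on (vmap f) (pverts G)"
    using monic_iff_inj by blast
  then show "card (pverts G) \<le> n"
    using card_inj_on_le[OF f(2), of "{..<n}"] vmap_in[OF f(1)] by auto
next
  assume le: "card (pverts G) \<le> n"
  obtain k where k: "pverts G = {..<k}" using G by (auto simp: graphs_def)
  have "gr_map G id (Disc n) \<in> hom_set Gr_bar G (Disc n)"
    using G Disc_graphs le k by (intro gr_map_hom) auto
  moreover have "inj_on (vmap (gr_map G id (Disc n))) (pverts G)"
    by (auto simp: inj_on_def)
  ultimately show "\<exists>f \<in> hom_set Gr_bar G (Disc n). monic Gr_bar f"
    using monic_iff_inj by blast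
qed

lemma isomorphicE:
  assumes "isomorphic Gr_bar G H"
  obtains u v where "u \<in> hom_set Gr_bar G H" "v \<in> hom_set Gr_bar H G"
    "v \<odot>\<^bsub>Gr_bar\<^esub> u = Id Gr_bar G" "u \<odot>\<^bsub>Gr_bar\<^esub> v = Id Gr_bar H"
    "\<And>x. x \<in> pverts G \<Longrightarrow> vmap v (vmap u x) = x" "\<And>y. y \<in> pverts H \<Longrightarrow> vmap u (vmap v y) = y"
proof -
  obtain u v where uv: "u \<in> hom_set Gr_bar G H" "v \<in> hom_set Gr_bar H G"
    "v \<odot>\<^bsub>Gr_bar\<^esub> u = Id Gr_bar G" "u \<odot>\<^bsub>Gr_bar\<^esub> v = Id Gr_bar H"
    using assms by (auto simp: isomorphic_def)
  have "vmap v (vmap u x) = x" if "x \<in> pverts G" for x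
    using arg_cong[OF uv(3), of "\<lambda>k. vmap k x"] uv(1) that by simp
  moreover have "vmap u (vmap v y) = y" if "y \<in> pverts H" for y
    using arg_cong[OF uv(4), of "\<lambda>k. vmap k y"] uv(2) that by simp
  ultimately show thesis using that uv by blast
qed

lemma isomorphic_refl: "G \<in> graphs \<Longrightarrow> isomorphic Gr_bar G G"
  unfolding isomorphic_def using Gr.id_hom[of G] Gr.comp_id[OF Gr.id_hom[of G]]
  by (intro bexI[of _ "Id Gr_bar G"]) auto

text \<open>In general an isomorphism may renumber the vertices, but a discrete graph on an initial
  segment is determined by its number of vertices. Hence the spine consists of the graphs
  \<open>Disc m\<close> themselves.\<close>

lemma isomorphic_Disc:
  assumes "isomorphic Gr_bar G (Disc n)"
  shows "G = Disc n"
proof -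
  obtain u v where uv: "u \<in> hom_set Gr_bar G (Disc n)" "v \<in> hom_set Gr_bar (Disc n) G"
    "\<And>x. x \<in> pverts G \<Longrightarrow> vmap v (vmap u x) = x"
    "\<And>y. y \<in> pverts (Disc n) \<Longrightarrow> vmap u (vmap v y) = y"
    using isomorphicE[OF assms] by metis
  have G: "G \<in> graphs" using Gr_bar_hom_graphs[OF uv(1)] by simp
  then obtain k where k: "pverts G = {..<k}" by (auto simp: graphs_def)
  have "bij_betw (vmap u) (pverts G) (pverts (Disc n))"
    by (rule bij_betw_byWitness[of _ "vmap v"]) (use uv vmap_in[OF uv(1)] vmap_in[OF uv(2)] in auto)
  from bij_betw_same_card[OF this] have "k = n" using k by simp
  moreover have "parcs G = {}"
  proof (rule ccontr)
    assume "parcs G \<noteq> {}"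
    then obtain x y where xy: "(x, y) \<in> parcs G" by auto
    then have "x \<in> pverts G" "y \<in> pverts G" using graphs_verts[OF G] by auto
    then show False
      using vmap_edge[OF uv(2), of "vmap u x" "vmap u y"] uv(3) xy vmap_in[OF uv(1)] by simp
  qed
  ultimately show ?thesis using k by (simp add: Disc_def)
qed

lemma Disc_spine_eq: "Disc_spine n = Disc ` {..n}"
  unfolding Disc_spine_def using isomorphic_Disc isomorphic_refl[OF Disc_graphs] Disc_graphs
  by auto

lemma monic_into_spine_iff:
  assumes "G \<in> graphs"
  shows "(\<exists>W \<in> Disc_spine n. \<exists>f \<in> hom_set Gr_bar G W. monic Gr_bar f) \<longleftrightarrow> card (pverts G) \<le> n"
  unfolding Disc_spine_eq using monic_into_Disc_iff[OF assms] by auto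

lemma spine_size_eq:
  assumes "G \<in> graphs"
  shows "spine_size Gr_bar Disc_spine G = card (pverts G)"
  unfolding spine_size_def monic_into_spine_iff[OF assms] by (rule Least_equality) auto

section \<open>Pullbacks\<close>

text \<open>The fibre product, described on vertices. The case \<open>x = x'\<close>,
  \<open>y = y'\<close> of the second clause says that every pair with a common image has a vertex
  above it, and the first clause makes that vertex unique. In general the second clause makes two
  vertices non-adjacent as soon as both coordinates are.\<close>

definition fibre_square ::
    "gr_arr \<Rightarrow> gr_arr \<Rightarrow> nat pair_pre_digraph \<Rightarrow> (nat \<Rightarrow> nat) \<Rightarrow> (nat \<Rightarrow> nat) \<Rightarrow> bool" where
  "fibre_square f g P p q \<longleftrightarrow>
    (\<forall>m \<in> pverts P. \<forall>m' \<in> pverts P. p m = p m' \<longrightarrow> q m = q m' \<longrightarrow> m = m') \<and>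
    (\<forall>x \<in> pverts (fst f). \<forall>x' \<in> pverts (fst f). \<forall>y \<in> pverts (fst g). \<forall>y' \<in> pverts (fst g).
      vmap f x = vmap g y \<longrightarrow> vmap f x' = vmap g y' \<longrightarrow>
      (x, x') \<notin> parcs (fst f) \<longrightarrow> (y, y') \<notin> parcs (fst g) \<longrightarrow>
      (\<exists>m \<in> pverts P. \<exists>m' \<in> pverts P. p m = x \<and> q m = y \<and> p m' = x' \<and> q m' = y' \<and>
        (m, m') \<notin> parcs P))"

lemma Gr_bar_hom_fst: "f \<in> hom_set Gr_bar G H \<Longrightarrow> fst f = G"
  by (auto simp: Gr_bar_hom_iff)

text \<open>The mediating map sends \<open>z\<close> to the unique vertex above
  \<open>vmap a z\<close> and \<open>vmap b z\<close>. It is an arrow because a non-adjacent pair of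
  \<open>Q\<close> has non-adjacent images under \<open>a\<close> and \<open>b\<close>, hence a
  non-adjacent pair above them.\<close>

lemma fibre_square_pullback:
  assumes f: "f \<in> hom_set Gr_bar A Y" and g: "g \<in> hom_set Gr_bar B Y"
    and p: "p \<in> hom_set Gr_bar P A" and q: "q \<in> hom_set Gr_bar P B"
    and comm: "f \<odot>\<^bsub>Gr_bar\<^esub> p = g \<odot>\<^bsub>Gr_bar\<^esub> q"
    and sq: "fibre_square f g P (vmap p) (vmap q)"
  shows "is_pullback Gr_bar f g P p q"
  unfolding is_pullback_def hom_setD(2,3)[OF f] hom_setD(2,3)[OF g]
proof (intro conjI ballI impI)
  have P: "P \<in> graphs" using Gr_bar_hom_graphs[OF p] by simp
  show "f \<in> Ar Gr_bar" "g \<in> Ar Gr_bar" "P \<in> Ob Gr_bar" using f g P by (auto simp: hom_setD)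
  show "p \<in> hom_set Gr_bar P A" "q \<in> hom_set Gr_bar P B"
    "f \<odot>\<^bsub>Gr_bar\<^esub> p = g \<odot>\<^bsub>Gr_bar\<^esub> q" "Y = Y" by (fact | rule refl)+
  have uniq: "m = m'" if "m \<in> pverts P" "m' \<in> pverts P" "vmap p m = vmap p m'" "vmap q m = vmap q m'" for m m'
    using sq that unfolding fibre_square_def by blast
  fix Q a b assume a: "a \<in> hom_set Gr_bar Q A" and b: "b \<in> hom_set Gr_bar Q B"
    and ab: "f \<odot>\<^bsub>Gr_bar\<^esub> a = g \<odot>\<^bsub>Gr_bar\<^esub> b"
  have Q: "Q \<in> graphs" using Gr_bar_hom_graphs[OF a] by simp
  have fg: "vmap f (vmap a z) = vmap g (vmap b z)" if "z \<in> pverts Q" for z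
    using arg_cong[OF ab, of "\<lambda>k. vmap k z"] a b that by simp
  have lift: "\<exists>m \<in> pverts P. \<exists>m' \<in> pverts P. vmap p m = vmap a z \<and> vmap q m = vmap b z \<and>
      vmap p m' = vmap a z' \<and> vmap q m' = vmap b z' \<and> (m, m') \<notin> parcs P"
    if z: "z \<in> pverts Q" "z' \<in> pverts Q" "(z, z') \<notin> parcs Q" for z z'
  proof -
    have "(vmap a z, vmap a z') \<notin> parcs A" "(vmap b z, vmap b z') \<notin> parcs B"
      using vmap_edge[OF a] vmap_edge[OF b] z by blast+
    then show ?thesis
      using sq fg[OF z(1)] fg[OF z(2)] z vmap_in[OF a] vmap_in[OF b]
      unfolding fibre_square_def Gr_bar_hom_fst[OF f] Gr_bar_hom_fst[OF g] by meson
  qed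
  define h where "h z = (SOME m. m \<in> pverts P \<and> vmap p m = vmap a z \<and> vmap q m = vmap b z)" for z
  have h: "h z \<in> pverts P \<and> vmap p (h z) = vmap a z \<and> vmap q (h z) = vmap b z"
    if "z \<in> pverts Q" for z
  proof -
    \<comment> \<open>Since \<open>z\<close> is not adjacent to itself, the statement about pairs
      also yields existence for a single vertex.\<close>
    have "\<exists>m. m \<in> pverts P \<and> vmap p m = vmap a z \<and> vmap q m = vmap b z"
      using lift[OF that that graphs_irrefl[OF Q]] by blast
    then show ?thesis unfolding h_def by (rule someI_ex)
  qed
  have h_eq: "h z = m" if "z \<in> pverts Q" "m \<in> pverts P" "vmap p m = vmap a z" "vmap q m = vmap b z"
    for z m using uniq h[OF that(1)] that by metis
  let ?u = "gr_map Q h P"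
  have u: "?u \<in> hom_set Gr_bar Q P"
  proof (rule gr_map_hom[OF Q P])
    fix z z' assume z: "z \<in> pverts Q" "z' \<in> pverts Q" "(h z, h z') \<in> parcs P"
    show "(z, z') \<in> parcs Q"
    proof (rule ccontr)
      assume "(z, z') \<notin> parcs Q"
      from lift[OF z(1,2) this] show False using h_eq z by metis
    qed
  qed (use h in blast)
  show "\<exists>!u. u \<in> hom_set Gr_bar Q P \<and> p \<odot>\<^bsub>Gr_bar\<^esub> u = a \<and> q \<odot>\<^bsub>Gr_bar\<^esub> u = b"
  proof (rule ex1I[of _ ?u], intro conjI)
    show "?u \<in> hom_set Gr_bar Q P" by (rule u)
    show "p \<odot>\<^bsub>Gr_bar\<^esub> ?u = a"
      by (rule Gr_bar_ext[OF Gr.comp_hom[OF u p] a]) (use u h in simp)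
    show "q \<odot>\<^bsub>Gr_bar\<^esub> ?u = b"
      by (rule Gr_bar_ext[OF Gr.comp_hom[OF u q] b]) (use u h in simp)
    fix w assume w: "w \<in> hom_set Gr_bar Q P \<and> p \<odot>\<^bsub>Gr_bar\<^esub> w = a \<and> q \<odot>\<^bsub>Gr_bar\<^esub> w = b"
    then have wh: "w \<in> hom_set Gr_bar Q P" by simp
    show "w = ?u"
    proof (rule Gr_bar_ext[OF wh u])
      fix z assume z: "z \<in> pverts Q"
      have "vmap p (vmap w z) = vmap a z" "vmap q (vmap w z) = vmap b z"
        using w vmap_comp[OF wh z] by metis+
      then show "vmap w z = vmap ?u z" using h_eq[OF z vmap_in[OF wh z]] z by simp
    qed
  qed
qed

lemma finite_enumeration:
  assumes "finite S"
  obtains e where "bij_betw e {..<card S} S"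
  using ex_bij_betw_nat_finite[OF assms] by (auto simp: atLeast0LessThan)

lemma pullback_exists:
  assumes f: "f \<in> hom_set Gr_bar A Y" and g: "g \<in> hom_set Gr_bar B Y"
  shows "\<exists>P p q. is_pullback Gr_bar f g P p q"
proof -
  have A: "A \<in> graphs" and B: "B \<in> graphs" using Gr_bar_hom_graphs f g by auto
  define S where "S = {(x, y). x \<in> pverts A \<and> y \<in> pverts B \<and> vmap f x = vmap g y}"
  have "S \<subseteq> pverts A \<times> pverts B" by (auto simp: S_def)
  then have "finite S" by (rule finite_subset) (simp add: graphs_finite A B)
  then obtain e where e: "bij_betw e {..<card S} S" using finite_enumeration by blast
  have eS: "e m \<in> S" if "m < card S" for m using bij_betwE[OF e] that by auto
  have e_inj: "m = m'" if "m < card S" "m' < card S" "e m = e m'" for m m'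
    using bij_betw_imp_inj_on[OF e] that by (auto simp: inj_on_def)
  have e_surj: "\<exists>m < card S. e m = s" if "s \<in> S" for s
    using bij_betw_imp_surj_on[OF e] that by (metis imageE lessThan_iff)
  \<comment> \<open>Arrows reflect adjacency, so the projections force the coordinates of an edge of
    \<open>P\<close> to be allowed: an edge in either coordinate suffices. Taking all of these edges
    makes non-adjacency in \<open>P\<close> the conjunction of non-adjacency in the two coordinates,
    as the universal property requires.\<close>
  define P :: "nat pair_pre_digraph" where "P = \<lparr>pverts = {..<card S}, parcs =
    {(m, m'). m < card S \<and> m' < card S \<and>
      ((fst (e m), fst (e m')) \<in> parcs A \<or> (snd (e m), snd (e m')) \<in> parcs B)}\<rparr>"
  have P: "P \<in> graphs"
    by (rule graphsI[of _ "card S"])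
      (auto simp: P_def graphs_irrefl A B dest: graphs_sym[OF A] graphs_sym[OF B])
  let ?p = "gr_map P (fst \<circ> e) A" and ?q = "gr_map P (snd \<circ> e) B"
  have p: "?p \<in> hom_set Gr_bar P A"
    using eS by (intro gr_map_hom[OF P A]) (auto simp: P_def S_def split_beta)
  have q: "?q \<in> hom_set Gr_bar P B"
    using eS by (intro gr_map_hom[OF P B]) (auto simp: P_def S_def split_beta)
  have V: "m \<in> pverts P \<longleftrightarrow> m < card S" for m by (simp add: P_def)
  have "f \<odot>\<^bsub>Gr_bar\<^esub> ?p = g \<odot>\<^bsub>Gr_bar\<^esub> ?q"
    by (rule Gr_bar_ext[OF Gr.comp_hom[OF p f] Gr.comp_hom[OF q g]])
      (use p q eS in \<open>auto simp: V S_def split_beta\<close>)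
  moreover have "fibre_square f g P (vmap ?p) (vmap ?q)"
    unfolding fibre_square_def Gr_bar_hom_fst[OF f] Gr_bar_hom_fst[OF g]
  proof (intro conjI ballI impI)
    fix m m' assume "m \<in> pverts P" "m' \<in> pverts P" "vmap ?p m = vmap ?p m'" "vmap ?q m = vmap ?q m'"
    then show "m = m'" using e_inj by (auto simp: V prod_eq_iff)
  next
    fix x x' y y' assume h: "x \<in> pverts A" "x' \<in> pverts A" "y \<in> pverts B" "y' \<in> pverts B"
      "vmap f x = vmap g y" "vmap f x' = vmap g y'" "(x, x') \<notin> parcs A" "(y, y') \<notin> parcs B"
    then have "(x, y) \<in> S" "(x', y') \<in> S" by (auto simp: S_def)
    then obtain m m' where m: "m < card S" "m' < card S" "e m = (x, y)" "e m' = (x', y')"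
      using e_surj by metis
    then have "(m, m') \<notin> parcs P" using h by (simp add: P_def)
    then show "\<exists>m \<in> pverts P. \<exists>m' \<in> pverts P. vmap ?p m = x \<and> vmap ?q m = y \<and>
      vmap ?p m' = x' \<and> vmap ?q m' = y' \<and> (m, m') \<notin> parcs P"
      using m by (intro bexI[of _ m] bexI[of _ m']) (auto simp: V)
  qed
  ultimately have "is_pullback Gr_bar f g P ?p ?q" by (rule fibre_square_pullback[OF f g p q])
  then show ?thesis by blast
qed

text \<open>Cones with apex \<open>Disc 2\<close> detect the structure of \<open>P\<close>. Constant
  ones separate its vertices, and two non-adjacent pairs with matching images induce an arrow into
  \<open>P\<close>, whose two values are non-adjacent.\<close>

lemma pullback_fibre_square:
  assumes f: "f \<in> hom_set Gr_bar A Y" and g: "g \<in> hom_set Gr_bar B Y"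
    and pb: "is_pullback Gr_bar f g P p q"
  shows "fibre_square f g P (vmap p) (vmap q)"
proof -
  have p: "p \<in> hom_set Gr_bar P A" and q: "q \<in> hom_set Gr_bar P B"
    and comm: "f \<odot>\<^bsub>Gr_bar\<^esub> p = g \<odot>\<^bsub>Gr_bar\<^esub> q"
    and univ: "\<And>Q a b. Q \<in> graphs \<Longrightarrow> a \<in> hom_set Gr_bar Q A \<Longrightarrow> b \<in> hom_set Gr_bar Q B \<Longrightarrow>
        f \<odot>\<^bsub>Gr_bar\<^esub> a = g \<odot>\<^bsub>Gr_bar\<^esub> b \<Longrightarrow>
        \<exists>!u. u \<in> hom_set Gr_bar Q P \<and> p \<odot>\<^bsub>Gr_bar\<^esub> u = a \<and> q \<odot>\<^bsub>Gr_bar\<^esub> u = b"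
    using pb unfolding is_pullback_def hom_setD(2,3)[OF f] hom_setD(2,3)[OF g] by auto
  have P: "P \<in> graphs" and A: "A \<in> graphs" and B: "B \<in> graphs"
    using Gr_bar_hom_graphs p q by auto
  show ?thesis
    unfolding fibre_square_def Gr_bar_hom_fst[OF f] Gr_bar_hom_fst[OF g]
  proof (intro conjI ballI impI)
    fix m m' assume m: "m \<in> pverts P" "m' \<in> pverts P" "vmap p m = vmap p m'" "vmap q m = vmap q m'"
    obtain u where u: "u \<in> hom_set Gr_bar (Disc 2) P" "vmap u 0 = m" "vmap u 1 = m"
      using pair_arrow[OF P m(1,1) graphs_irrefl[OF P]] by blast
    obtain v where v: "v \<in> hom_set Gr_bar (Disc 2) P" "vmap v 0 = m'" "vmap v 1 = m'"
      using pair_arrow[OF P m(2,2) graphs_irrefl[OF P]] by blast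
    have "p \<odot>\<^bsub>Gr_bar\<^esub> u = p \<odot>\<^bsub>Gr_bar\<^esub> v" "q \<odot>\<^bsub>Gr_bar\<^esub> u = q \<odot>\<^bsub>Gr_bar\<^esub> v"
      using u v m
      by (auto intro!: pair_arrow_eqI[OF Gr.comp_hom[OF u(1) p] Gr.comp_hom[OF v(1) p]]
          pair_arrow_eqI[OF Gr.comp_hom[OF u(1) q] Gr.comp_hom[OF v(1) q]])
    moreover have "f \<odot>\<^bsub>Gr_bar\<^esub> (p \<odot>\<^bsub>Gr_bar\<^esub> u) = g \<odot>\<^bsub>Gr_bar\<^esub> (q \<odot>\<^bsub>Gr_bar\<^esub> u)"
      using Gr.comp_assoc[OF u(1) p f] Gr.comp_assoc[OF u(1) q g] comm by simp
    ultimately have "u = v"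
      using univ[OF Disc_graphs Gr.comp_hom[OF u(1) p] Gr.comp_hom[OF u(1) q]] u(1) v(1) by metis
    then show "m = m'" using u v by simp
  next
    fix x x' y y' assume h: "x \<in> pverts A" "x' \<in> pverts A" "y \<in> pverts B" "y' \<in> pverts B"
      "vmap f x = vmap g y" "vmap f x' = vmap g y'" "(x, x') \<notin> parcs A" "(y, y') \<notin> parcs B"
    obtain a where a: "a \<in> hom_set Gr_bar (Disc 2) A" "vmap a 0 = x" "vmap a 1 = x'"
      using pair_arrow[OF A h(1,2,7)] by blast
    obtain b where b: "b \<in> hom_set Gr_bar (Disc 2) B" "vmap b 0 = y" "vmap b 1 = y'"
      using pair_arrow[OF B h(3,4,8)] by blast
    have "f \<odot>\<^bsub>Gr_bar\<^esub> a = g \<odot>\<^bsub>Gr_bar\<^esub> b"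
      by (rule pair_arrow_eqI[OF Gr.comp_hom[OF a(1) f] Gr.comp_hom[OF b(1) g]])
        (use a b h in auto)
    then obtain u where u: "u \<in> hom_set Gr_bar (Disc 2) P"
      "p \<odot>\<^bsub>Gr_bar\<^esub> u = a" "q \<odot>\<^bsub>Gr_bar\<^esub> u = b"
      using univ[OF Disc_graphs a(1) b(1)] by blast
    have uv: "vmap p (vmap u i) = vmap a i" "vmap q (vmap u i) = vmap b i" if "i < 2" for i
      using vmap_comp[OF u(1), of i p] vmap_comp[OF u(1), of i q] u(2,3) that by auto
    have "(vmap u 0, vmap u 1) \<notin> parcs P" using vmap_edge[OF u(1), of 0 1] by auto
    then show "\<exists>m \<in> pverts P. \<exists>m' \<in> pverts P. vmap p m = x \<and> vmap q m = y \<and>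
      vmap p m' = x' \<and> vmap q m' = y' \<and> (m, m') \<notin> parcs P"
      using uv[of 0] uv[of 1] a b vmap_in[OF u(1)]
      by (intro bexI[of _ "vmap u 0"] bexI[of _ "vmap u 1"]) auto
  qed
qed

section \<open>Colimits\<close>

text \<open>Generates, on the disjoint union of the vertex sets, the equivalence relation whose
  classes are the vertices of a colimit. The object is part of the pair because the vertex sets are
  initial segments and overlap.\<close>

definition fibre_step ::
    "('i, 'j) cat \<Rightarrow> ('i, 'j, nat pair_pre_digraph, gr_arr) diagram \<Rightarrow> ('i \<times> nat) rel" where
  "fibre_step J d = {((Dom J u, a), (Cod J u, vmap (farr d u) a)) | u a.
     u \<in> Ar J \<and> a \<in> pverts (fobj d (Dom J u))}"

definition zigzag ::
    "('i, 'j) cat \<Rightarrow> ('i, 'j, nat pair_pre_digraph, gr_arr) diagram \<Rightarrow> ('i \<times> nat) rel" where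
  "zigzag J d = (fibre_step J d \<union> (fibre_step J d)\<inverse>)\<^sup>*"

text \<open>
  Since no vertex is adjacent to itself, the case \<open>x = y\<close> of the last condition says that the
  cocone is jointly surjective. These cocones are exactly the colimits.
\<close>

definition glued ::
    "('i, 'j) cat \<Rightarrow> ('i, 'j, nat pair_pre_digraph, gr_arr) diagram \<Rightarrow> nat pair_pre_digraph \<Rightarrow>
     ('i \<Rightarrow> gr_arr) \<Rightarrow> bool" where
  "glued J d X \<iota> \<longleftrightarrow> is_cocone J Gr_bar d X \<iota> \<and>
    (\<forall>i \<in> Ob J. \<forall>j \<in> Ob J. \<forall>a \<in> pverts (fobj d i). \<forall>b \<in> pverts (fobj d j).
      vmap (\<iota> i) a = vmap (\<iota> j) b \<longrightarrow> ((i, a), (j, b)) \<in> zigzag J d) \<and>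
    (\<forall>x \<in> pverts X. \<forall>y \<in> pverts X. (x, y) \<notin> parcs X \<longrightarrow>
      (\<exists>i \<in> Ob J. \<exists>a \<in> pverts (fobj d i). \<exists>b \<in> pverts (fobj d i).
        vmap (\<iota> i) a = x \<and> vmap (\<iota> i) b = y \<and> (a, b) \<notin> parcs (fobj d i)))"

lemma
  assumes "glued J d X \<iota>"
  shows glued_cocone: "is_cocone J Gr_bar d X \<iota>"
    and glued_zigzag: "\<lbrakk>i \<in> Ob J; j \<in> Ob J; a \<in> pverts (fobj d i); b \<in> pverts (fobj d j);
      vmap (\<iota> i) a = vmap (\<iota> j) b\<rbrakk> \<Longrightarrow> ((i, a), (j, b)) \<in> zigzag J d"
    and glued_nonadjacent: "\<lbrakk>x \<in> pverts X; y \<in> pverts X; (x, y) \<notin> parcs X\<rbrakk> \<Longrightarrow>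
      \<exists>i \<in> Ob J. \<exists>a \<in> pverts (fobj d i). \<exists>b \<in> pverts (fobj d i).
        vmap (\<iota> i) a = x \<and> vmap (\<iota> i) b = y \<and> (a, b) \<notin> parcs (fobj d i)"
  using assms unfolding glued_def by simp_all

lemma
  assumes "is_cocone J Gr_bar d X \<iota>"
  shows cocone_apex: "X \<in> graphs"
    and cocone_hom: "i \<in> Ob J \<Longrightarrow> \<iota> i \<in> hom_set Gr_bar (fobj d i) X"
  using assms by (simp_all add: is_cocone_def)

lemma functor_hom:
  assumes "is_functor J C d" "u \<in> Ar J"
  shows "farr d u \<in> hom_set C (fobj d (Dom J u)) (fobj d (Cod J u))"
  using assms by (simp add: is_functor_def)

lemma functor_ob:
  assumes "is_functor J C d" "i \<in> Ob J"
  shows "fobj d i \<in> Ob C"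
  using assms by (simp add: is_functor_def)

lemma cocone_vmap:
  assumes "is_functor J Gr_bar d" "is_cocone J Gr_bar d X \<iota>"
    and u: "u \<in> Ar J" "a \<in> pverts (fobj d (Dom J u))"
  shows "vmap (\<iota> (Cod J u)) (vmap (farr d u) a) = vmap (\<iota> (Dom J u)) a"
proof -
  have "\<iota> (Cod J u) \<odot>\<^bsub>Gr_bar\<^esub> farr d u = \<iota> (Dom J u)"
    using assms(2) u(1) by (simp add: is_cocone_def)
  then show ?thesis using vmap_comp[OF functor_hom[OF assms(1) u(1)] u(2)] by metis
qed

lemma cocone_zigzag:
  assumes d: "is_functor J Gr_bar d" and \<iota>: "is_cocone J Gr_bar d X \<iota>"
    and "(s, t) \<in> zigzag J d"
  shows "vmap (\<iota> (fst s)) (snd s) = vmap (\<iota> (fst t)) (snd t)"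
  using assms(3) unfolding zigzag_def
proof (induction rule: rtrancl_induct)
  case (step t t')
  then show ?case using cocone_vmap[OF d \<iota>] by (auto simp: fibre_step_def)
qed simp

lemma zigzag_refl: "(s, s) \<in> zigzag J d"
  by (simp add: zigzag_def)

lemma zigzag_trans: "(s, t) \<in> zigzag J d \<Longrightarrow> (t, r) \<in> zigzag J d \<Longrightarrow> (s, r) \<in> zigzag J d"
  unfolding zigzag_def by (rule rtrancl_trans)

lemma zigzag_sym: "(s, t) \<in> zigzag J d \<Longrightarrow> (t, s) \<in> zigzag J d"
  unfolding zigzag_def by (meson sym_Un_converse sym_rtrancl symD)

lemma zigzag_step:
  assumes "u \<in> Ar J" "a \<in> pverts (fobj d (Dom J u))"
  shows "((Dom J u, a), (Cod J u, vmap (farr d u) a)) \<in> zigzag J d"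
  unfolding zigzag_def fibre_step_def using assms by blast

text \<open>Two representatives of a vertex are linked by a zigzag, along which every cocone is
  constant, so the mediating map is well defined. It is an arrow because a non-adjacent pair of
  \<open>X\<close> is already non-adjacent in one bag, and the leg of \<kappa> there keeps it
  so.\<close>

lemma glued_colimit:
  assumes d: "is_functor J Gr_bar d" and g: "glued J d X \<iota>"
  shows "is_colimit J Gr_bar d X \<iota>"
  unfolding is_colimit_def
proof (intro conjI allI impI)
  show c: "is_cocone J Gr_bar d X \<iota>" using g by (rule glued_cocone)
  note \<iota> = cocone_hom[OF c]
  have X: "X \<in> graphs" using c by (rule cocone_apex)
  fix Y \<kappa> assume k: "is_cocone J Gr_bar d Y \<kappa>"
  note \<kappa> = cocone_hom[OF k]
  have Y: "Y \<in> graphs" using k by (rule cocone_apex)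
  have well: "vmap (\<kappa> i) a = vmap (\<kappa> j) b"
    if "i \<in> Ob J" "j \<in> Ob J" "a \<in> pverts (fobj d i)" "b \<in> pverts (fobj d j)"
      "vmap (\<iota> i) a = vmap (\<iota> j) b" for i j a b
    using cocone_zigzag[OF d k glued_zigzag[OF g that]] by simp
  define h where "h x = (SOME y. \<exists>i \<in> Ob J. \<exists>a \<in> pverts (fobj d i).
    vmap (\<iota> i) a = x \<and> y = vmap (\<kappa> i) a)" for x
  have h: "h (vmap (\<iota> i) a) = vmap (\<kappa> i) a" if "i \<in> Ob J" "a \<in> pverts (fobj d i)" for i a
    unfolding h_def by (rule some_equality) (use that well in blast)+
  have cover: "\<exists>i \<in> Ob J. \<exists>a \<in> pverts (fobj d i). vmap (\<iota> i) a = x" if "x \<in> pverts X" for x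
    using glued_nonadjacent[OF g that that graphs_irrefl[OF X]] by blast
  let ?u = "gr_map X h Y"
  have u: "?u \<in> hom_set Gr_bar X Y"
  proof (rule gr_map_hom[OF X Y])
    fix x assume "x \<in> pverts X"
    then obtain i a where "i \<in> Ob J" "a \<in> pverts (fobj d i)" "vmap (\<iota> i) a = x"
      using cover by blast
    then show "h x \<in> pverts Y" using h vmap_in[OF \<kappa>] by metis
  next
    fix x y assume xy: "x \<in> pverts X" "y \<in> pverts X" "(h x, h y) \<in> parcs Y"
    show "(x, y) \<in> parcs X"
    proof (rule ccontr)
      assume "(x, y) \<notin> parcs X"
      then obtain i a b where i: "i \<in> Ob J" "a \<in> pverts (fobj d i)" "b \<in> pverts (fobj d i)"
        "vmap (\<iota> i) a = x" "vmap (\<iota> i) b = y" "(a, b) \<notin> parcs (fobj d i)"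
        using glued_nonadjacent[OF g xy(1,2)] by blast
      have "h x = vmap (\<kappa> i) a" "h y = vmap (\<kappa> i) b" using h i by auto
      then show False using vmap_edge[OF \<kappa>[OF i(1)] i(2,3)] xy(3) i(6) by simp
    qed
  qed
  show "\<exists>!u. u \<in> hom_set Gr_bar X Y \<and> (\<forall>i \<in> Ob J. u \<odot>\<^bsub>Gr_bar\<^esub> \<iota> i = \<kappa> i)"
  proof (rule ex1I[of _ ?u], intro conjI ballI)
    show "?u \<in> hom_set Gr_bar X Y" by (rule u)
    fix i assume i: "i \<in> Ob J"
    show "?u \<odot>\<^bsub>Gr_bar\<^esub> \<iota> i = \<kappa> i"
      by (rule Gr_bar_ext[OF Gr.comp_hom[OF \<iota>[OF i] u] \<kappa>[OF i]])
        (use \<iota>[OF i] vmap_in[OF \<iota>[OF i]] h[OF i] in simp)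
  next
    fix w assume w: "w \<in> hom_set Gr_bar X Y \<and> (\<forall>i \<in> Ob J. w \<odot>\<^bsub>Gr_bar\<^esub> \<iota> i = \<kappa> i)"
    show "w = ?u"
    proof (rule Gr_bar_ext[OF conjunct1[OF w] u])
      fix x assume x: "x \<in> pverts X"
      then obtain i a where ia: "i \<in> Ob J" "a \<in> pverts (fobj d i)" "vmap (\<iota> i) a = x"
        using cover by blast
      then have "vmap w x = vmap (\<kappa> i) a" using vmap_comp[OF \<iota>[OF ia(1)] ia(2)] w by metis
      then show "vmap w x = vmap ?u x" using h[OF ia(1,2)] ia(3) x by simp
    qed
  qed
qed

text \<open>The vertices are the zigzag classes. The legs have to reflect adjacency, and the
  universal choice is the largest edge set that they allow.\<close>

lemma glued_exists:
  assumes J: "category J" and fin: "finite (Ob J)" and d: "is_functor J Gr_bar d"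
  shows "\<exists>X \<iota>. glued J d X \<iota>"
proof -
  interpret J: category J by fact
  have dO: "fobj d i \<in> graphs" if "i \<in> Ob J" for i using functor_ob[OF d that] by simp
  define S where "S = (SIGMA i : Ob J. pverts (fobj d i))"
  define cls where "cls s = {t \<in> S. (s, t) \<in> zigzag J d}" for s
  have cls: "cls s = cls t \<longleftrightarrow> (s, t) \<in> zigzag J d" if "t \<in> S" for s t
    using that zigzag_refl zigzag_trans zigzag_sym unfolding cls_def by blast
  define n where "n = card (cls ` S)"
  have "finite (cls ` S)" using fin dO graphs_finite by (simp add: S_def)
  then obtain e where e: "bij_betw e (cls ` S) {..<n}"
    unfolding n_def by (metis finite_enumeration bij_betw_inv)
  define h where "h = e \<circ> cls"
  have h_eq: "h s = h t \<longleftrightarrow> (s, t) \<in> zigzag J d" if "s \<in> S" "t \<in> S" for s t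
    using cls[OF that(2)] inj_on_eq_iff[OF bij_betw_imp_inj_on[OF e], of "cls s" "cls t"] that
    by (simp add: h_def)
  have h_less: "h s < n" if "s \<in> S" for s
    using bij_betwE[OF e] that by (auto simp: h_def)
  have h_surj: "\<exists>s \<in> S. h s = x" if "x < n" for x
  proof -
    have "x \<in> h ` S" using bij_betw_imp_surj_on[OF e] that by (simp add: h_def image_comp)
    then show ?thesis by blast
  qed
  \<comment> \<open>For two vertices without representatives in a common bag the condition is
    vacuous, so they are adjacent: in the complement, only pairs from one bag can form an
    edge.\<close>
  define X :: "nat pair_pre_digraph" where "X = \<lparr>pverts = {..<n}, parcs = {(x, y). x < n \<and> y < n \<and>
    (\<forall>i \<in> Ob J. \<forall>a \<in> pverts (fobj d i). \<forall>b \<in> pverts (fobj d i).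
      h (i, a) = x \<longrightarrow> h (i, b) = y \<longrightarrow> (a, b) \<in> parcs (fobj d i))}\<rparr>"
  have X: "X \<in> graphs"
  proof (rule graphsI[of _ n]; (intro conjI)?)
    fix x y assume xy: "(x, y) \<in> parcs X"
    then show "x < n" "y < n" by (auto simp: X_def)
    then obtain i a where ia: "i \<in> Ob J" "a \<in> pverts (fobj d i)" "h (i, a) = x"
      using h_surj unfolding S_def by blast
    have "(a, b) \<in> parcs (fobj d i)" if "b \<in> pverts (fobj d i)" "h (i, b) = y" for b
      using xy ia that by (simp add: X_def)
    \<comment> \<open>If \<open>x = y\<close>, the representative \<open>a\<close> of
      \<open>x\<close> would be adjacent to itself.\<close>
    then show "x \<noteq> y" using ia graphs_irrefl[OF dO] by blast
    show "(y, x) \<in> parcs X" using xy graphs_sym[OF dO] by (auto simp: X_def)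
  qed (simp add: X_def)
  define \<iota> where "\<iota> i = gr_map (fobj d i) (\<lambda>a. h (i, a)) X" for i
  have \<iota>: "\<iota> i \<in> hom_set Gr_bar (fobj d i) X" if "i \<in> Ob J" for i
    unfolding \<iota>_def using h_less that by (intro gr_map_hom dO X) (auto simp: X_def S_def)
  have v: "vmap (\<iota> i) a = h (i, a)" if "a \<in> pverts (fobj d i)" for i a
    using that by (simp add: \<iota>_def)
  have "glued J d X \<iota>"
    unfolding glued_def
  proof (intro conjI ballI impI)
    show "is_cocone J Gr_bar d X \<iota>"
      unfolding is_cocone_def
    proof (intro conjI ballI)
      fix u assume u: "u \<in> Ar J"
      note du = functor_hom[OF d u]
      note i = J.Dom_in[OF u] J.Cod_in[OF u]
      show "\<iota> (Cod J u) \<odot>\<^bsub>Gr_bar\<^esub> farr d u = \<iota> (Dom J u)"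
      proof (rule Gr_bar_ext[OF Gr.comp_hom[OF du \<iota>[OF i(2)]] \<iota>[OF i(1)]])
        fix a assume a: "a \<in> pverts (fobj d (Dom J u))"
        have "h (Dom J u, a) = h (Cod J u, vmap (farr d u) a)"
          using zigzag_step[OF u a] a i vmap_in[OF du a] by (subst h_eq) (auto simp: S_def)
        then show "vmap (\<iota> (Cod J u) \<odot>\<^bsub>Gr_bar\<^esub> farr d u) a = vmap (\<iota> (Dom J u)) a"
          using vmap_comp[OF du a] v a vmap_in[OF du a] by simp
      qed
    qed (use X \<iota> in auto)
    fix i j a b assume "i \<in> Ob J" "j \<in> Ob J" "a \<in> pverts (fobj d i)" "b \<in> pverts (fobj d j)"
      "vmap (\<iota> i) a = vmap (\<iota> j) b"
    then show "((i, a), (j, b)) \<in> zigzag J d"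
      using h_eq[of "(i, a)" "(j, b)"] v by (simp add: S_def)
  next
    fix x y assume xy: "x \<in> pverts X" "y \<in> pverts X" "(x, y) \<notin> parcs X"
    then obtain i a b where "i \<in> Ob J" "a \<in> pverts (fobj d i)" "b \<in> pverts (fobj d i)"
      "h (i, a) = x" "h (i, b) = y" "(a, b) \<notin> parcs (fobj d i)"
      by (auto simp: X_def)
    then show "\<exists>i \<in> Ob J. \<exists>a \<in> pverts (fobj d i). \<exists>b \<in> pverts (fobj d i).
        vmap (\<iota> i) a = x \<and> vmap (\<iota> i) b = y \<and> (a, b) \<notin> parcs (fobj d i)"
      using v by metis
  qed
  then show ?thesis by blast
qed

text \<open>Transport from a glued cocone on \<open>Y\<close>: equality of images and non-adjacency
  pass to \<open>Y\<close> along \<open>u\<close>, and the representatives found there are brought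
  back along \<open>v\<close>.\<close>

lemma colimit_glued:
  assumes J: "category J" and fin: "finite (Ob J)" and d: "is_functor J Gr_bar d"
    and X: "is_colimit J Gr_bar d X \<iota>"
  shows "glued J d X \<iota>"
proof -
  have c: "is_cocone J Gr_bar d X \<iota>" using X by (simp add: is_colimit_def)
  note \<iota> = cocone_hom[OF c]
  obtain Y \<kappa> where g: "glued J d Y \<kappa>" using glued_exists[OF J fin d] by blast
  note \<kappa> = cocone_hom[OF glued_cocone[OF g]]
  obtain u v where u: "u \<in> hom_set Gr_bar X Y" and v: "v \<in> hom_set Gr_bar Y X"
    and vu: "v \<odot>\<^bsub>Gr_bar\<^esub> u = Id Gr_bar X"
    and u\<iota>: "\<And>i. i \<in> Ob J \<Longrightarrow> u \<odot>\<^bsub>Gr_bar\<^esub> \<iota> i = \<kappa> i"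
    and v\<kappa>: "\<And>i. i \<in> Ob J \<Longrightarrow> v \<odot>\<^bsub>Gr_bar\<^esub> \<kappa> i = \<iota> i"
    using Gr.colimit_unique[OF X glued_colimit[OF d g]] by metis
  have vu: "vmap v (vmap u x) = x" if "x \<in> pverts X" for x
    using arg_cong[OF vu, of "\<lambda>k. vmap k x"] u that by simp
  have u\<iota>: "vmap (\<kappa> i) a = vmap u (vmap (\<iota> i) a)" if "i \<in> Ob J" "a \<in> pverts (fobj d i)" for i a
    using vmap_comp[OF \<iota>[OF that(1)] that(2)] u\<iota>[OF that(1)] by metis
  have v\<kappa>: "vmap (\<iota> i) a = vmap v (vmap (\<kappa> i) a)" if "i \<in> Ob J" "a \<in> pverts (fobj d i)" for i a
    using vmap_comp[OF \<kappa>[OF that(1)] that(2)] v\<kappa>[OF that(1)] by metis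
  show ?thesis
    unfolding glued_def
  proof (intro conjI ballI impI)
    show "is_cocone J Gr_bar d X \<iota>" by (rule c)
    fix i j a b assume "i \<in> Ob J" "j \<in> Ob J" "a \<in> pverts (fobj d i)" "b \<in> pverts (fobj d j)"
      "vmap (\<iota> i) a = vmap (\<iota> j) b"
    then show "((i, a), (j, b)) \<in> zigzag J d" using glued_zigzag[OF g] u\<iota> by metis
  next
    fix x y assume xy: "x \<in> pverts X" "y \<in> pverts X" "(x, y) \<notin> parcs X"
    then have "(vmap u x, vmap u y) \<notin> parcs Y" using vmap_edge[OF u] by blast
    then obtain i a b where i: "i \<in> Ob J" "a \<in> pverts (fobj d i)" "b \<in> pverts (fobj d i)"
      "vmap (\<kappa> i) a = vmap u x" "vmap (\<kappa> i) b = vmap u y" "(a, b) \<notin> parcs (fobj d i)"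
      using glued_nonadjacent[OF g vmap_in[OF u xy(1)] vmap_in[OF u xy(2)]] by blast
    then have "vmap (\<iota> i) a = x" "vmap (\<iota> i) b = y" using v\<kappa> vu xy by auto
    then show "\<exists>i \<in> Ob J. \<exists>a \<in> pverts (fobj d i). \<exists>b \<in> pverts (fobj d i).
        vmap (\<iota> i) a = x \<and> vmap (\<iota> i) b = y \<and> (a, b) \<notin> parcs (fobj d i)"
      using i by blast
  qed
qed

text \<open>Over a fixed vertex \<open>x\<close> of \<open>X\<close>, the vertices of
  \<open>d'\<close> correspond through \<open>q\<close> to the vertices of \<open>d\<close> above
  \<open>vmap f x\<close>, compatibly with the arrows of the two diagrams. Hence zigzags can be
  lifted from \<open>d\<close> to \<open>d'\<close>.\<close>

lemma glued_pullback:
  assumes J: "category J" and d: "is_functor J Gr_bar d" and g: "glued J d Y \<iota>"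
    and f: "f \<in> hom_set Gr_bar X Y" and pb: "is_pullback_cocone J Gr_bar d \<iota> f d' p q"
  shows "glued J d' X p"
proof -
  interpret J: category J by fact
  note c = glued_cocone[OF g]
  note \<iota> = cocone_hom[OF c]
  have X: "X \<in> graphs" using Gr_bar_hom_graphs[OF f] by simp
  have d': "is_functor J Gr_bar d'"
    and P: "\<And>i. i \<in> Ob J \<Longrightarrow> is_pullback Gr_bar f (\<iota> i) (fobj d' i) (p i) (q i)"
    and nq: "\<And>u. u \<in> Ar J \<Longrightarrow> q (Cod J u) \<odot>\<^bsub>Gr_bar\<^esub> farr d' u = farr d u \<odot>\<^bsub>Gr_bar\<^esub> q (Dom J u)"
    and np: "\<And>u. u \<in> Ar J \<Longrightarrow> p (Cod J u) \<odot>\<^bsub>Gr_bar\<^esub> farr d' u = p (Dom J u)"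
    using pb unfolding is_pullback_cocone_def by auto
  have p: "p i \<in> hom_set Gr_bar (fobj d' i) X" and q: "q i \<in> hom_set Gr_bar (fobj d' i) (fobj d i)"
    and comm: "f \<odot>\<^bsub>Gr_bar\<^esub> p i = \<iota> i \<odot>\<^bsub>Gr_bar\<^esub> q i" if "i \<in> Ob J" for i
    using P[OF that] unfolding is_pullback_def hom_setD(2,3)[OF f] hom_setD(2,3)[OF \<iota>[OF that]]
    by auto
  have comm: "vmap f (vmap (p i) m) = vmap (\<iota> i) (vmap (q i) m)"
    if "i \<in> Ob J" "m \<in> pverts (fobj d' i)" for i m
    using arg_cong[OF comm[OF that(1)], of "\<lambda>k. vmap k m"] p[OF that(1)] q[OF that(1)] that(2)
    by simp
  have nq: "vmap (q (Cod J u)) (vmap (farr d' u) m) = vmap (farr d u) (vmap (q (Dom J u)) m)"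
    and np: "vmap (p (Cod J u)) (vmap (farr d' u) m) = vmap (p (Dom J u)) m"
    if u: "u \<in> Ar J" and m: "m \<in> pverts (fobj d' (Dom J u))" for u m
    using arg_cong[OF nq[OF u], of "\<lambda>k. vmap k m"] arg_cong[OF np[OF u], of "\<lambda>k. vmap k m"]
      functor_hom[OF d' u] q[OF J.Dom_in[OF u]] m by simp_all
  have sq: "fibre_square f (\<iota> i) (fobj d' i) (vmap (p i)) (vmap (q i))" if "i \<in> Ob J" for i
    using pullback_fibre_square[OF f \<iota>[OF that] P[OF that]] .
  have uniq: "m = m'"
    if "i \<in> Ob J" "m \<in> pverts (fobj d' i)" "m' \<in> pverts (fobj d' i)"
      "vmap (p i) m = vmap (p i) m'" "vmap (q i) m = vmap (q i) m'" for i m m'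
    using sq[OF that(1)] that(2-) unfolding fibre_square_def by blast
  have lift2: "\<exists>m \<in> pverts (fobj d' i). \<exists>m' \<in> pverts (fobj d' i). vmap (p i) m = x \<and>
      vmap (q i) m = a \<and> vmap (p i) m' = y \<and> vmap (q i) m' = b \<and> (m, m') \<notin> parcs (fobj d' i)"
    if "i \<in> Ob J" "x \<in> pverts X" "y \<in> pverts X" "a \<in> pverts (fobj d i)" "b \<in> pverts (fobj d i)"
      "vmap f x = vmap (\<iota> i) a" "vmap f y = vmap (\<iota> i) b"
      "(x, y) \<notin> parcs X" "(a, b) \<notin> parcs (fobj d i)" for i x y a b
    using sq[OF that(1)] that(2-)
    unfolding fibre_square_def Gr_bar_hom_fst[OF f] Gr_bar_hom_fst[OF \<iota>[OF that(1)]] by simp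
  have lift: "\<exists>m \<in> pverts (fobj d' i). vmap (p i) m = x \<and> vmap (q i) m = a"
    if "i \<in> Ob J" "x \<in> pverts X" "a \<in> pverts (fobj d i)" "vmap f x = vmap (\<iota> i) a" for i x a
    using lift2[OF that(1,2,2,3,3,4,4) graphs_irrefl[OF X] graphs_irrefl]
      Gr_bar_hom_graphs(1)[OF \<iota>[OF that(1)]] by blast
  \<comment> \<open>The lift stays above the same vertex of \<open>X\<close>; its end is then
    determined by the end of the given zigzag.\<close>
  have lift_zigzag: "\<exists>m'. fst t \<in> Ob J \<and> m' \<in> pverts (fobj d' (fst t)) \<and>
      vmap (p (fst t)) m' = vmap (p i) m \<and> vmap (q (fst t)) m' = snd t \<and>
      ((i, m), (fst t, m')) \<in> zigzag J d'"
    if i: "i \<in> Ob J" and m: "m \<in> pverts (fobj d' i)" and t: "((i, vmap (q i) m), t) \<in> zigzag J d"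
    for i m t
    using t unfolding zigzag_def[of J d]
  proof (induction rule: rtrancl_induct)
    case base
    show ?case using i m zigzag_refl by (intro exI[of _ m]) simp
  next
    case (step t t')
    then obtain m' where m': "fst t \<in> Ob J" "m' \<in> pverts (fobj d' (fst t))"
      "vmap (p (fst t)) m' = vmap (p i) m" "vmap (q (fst t)) m' = snd t"
      "((i, m), (fst t, m')) \<in> zigzag J d'" by blast
    from step.hyps(2) show ?case
    proof
      assume "(t, t') \<in> fibre_step J d"
      then obtain u a where u: "u \<in> Ar J" and t: "t = (Dom J u, a)"
        and t': "t' = (Cod J u, vmap (farr d u) a)" by (auto simp: fibre_step_def)
      let ?m = "vmap (farr d' u) m'"
      have m'': "m' \<in> pverts (fobj d' (Dom J u))" using m' t by simp
      have "?m \<in> pverts (fobj d' (Cod J u))" using vmap_in[OF functor_hom[OF d' u] m''] .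
      moreover have "((i, m), (Cod J u, ?m)) \<in> zigzag J d'"
        using zigzag_trans[OF m'(5)] zigzag_step[OF u m''] t by simp
      ultimately show ?thesis
        using nq[OF u m''] np[OF u m''] m' t t' J.Cod_in[OF u] by (intro exI[of _ ?m]) simp
    next
      assume "(t, t') \<in> (fibre_step J d)\<inverse>"
      then obtain u a where u: "u \<in> Ar J" and a: "a \<in> pverts (fobj d (Dom J u))"
        and t': "t' = (Dom J u, a)" and t: "t = (Cod J u, vmap (farr d u) a)"
        by (auto simp: fibre_step_def)
      note Ob = J.Dom_in[OF u] J.Cod_in[OF u]
      \<comment> \<open>A backward step cannot be followed by applying an arrow. The pullback
        provides a vertex \<open>k\<close> above \<open>a\<close>, and joint injectivity shows that
        \<open>k\<close> is sent to \<open>m'\<close>.\<close>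
      have "vmap f (vmap (p i) m) = vmap (\<iota> (Cod J u)) (vmap (farr d u) a)"
        using comm[OF m'(1,2)] m'(3,4) t by simp
      also have "\<dots> = vmap (\<iota> (Dom J u)) a" using cocone_vmap[OF d c u a] .
      finally obtain k where k: "k \<in> pverts (fobj d' (Dom J u))"
        "vmap (p (Dom J u)) k = vmap (p i) m" "vmap (q (Dom J u)) k = a"
        using lift[OF Ob(1) vmap_in[OF p[OF i] m] a] by blast
      have "vmap (farr d' u) k = m'"
        by (rule uniq[OF Ob(2)])
          (use vmap_in[OF functor_hom[OF d' u] k(1)] m' t k nq[OF u k(1)] np[OF u k(1)] in auto)
      then have "((fst t, m'), (Dom J u, k)) \<in> zigzag J d'"
        using zigzag_sym[OF zigzag_step[where d = d', OF u k(1)]] t by simp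
      then show ?thesis
        using zigzag_trans[OF m'(5)] k t' Ob(1) by (intro exI[of _ k]) simp
    qed
  qed
  show ?thesis
    unfolding glued_def
  proof (intro conjI ballI impI)
    show "is_cocone J Gr_bar d' X p"
      using pb X p unfolding is_cocone_def is_pullback_cocone_def by simp
    fix i j m k assume h: "i \<in> Ob J" "j \<in> Ob J" "m \<in> pverts (fobj d' i)" "k \<in> pverts (fobj d' j)"
      "vmap (p i) m = vmap (p j) k"
    have "((i, vmap (q i) m), (j, vmap (q j) k)) \<in> zigzag J d"
      using comm[OF h(1,3)] comm[OF h(2,4)] h(5)
      by (intro glued_zigzag[OF g h(1,2) vmap_in[OF q[OF h(1)] h(3)] vmap_in[OF q[OF h(2)] h(4)]]) simp
    then obtain k' where k': "k' \<in> pverts (fobj d' j)" "vmap (p j) k' = vmap (p i) m"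
      "vmap (q j) k' = vmap (q j) k" "((i, m), (j, k')) \<in> zigzag J d'"
      using lift_zigzag[OF h(1,3)] by fastforce
    then have "k' = k" using uniq[OF h(2) k'(1) h(4)] h(5) by simp
    with k' show "((i, m), (j, k)) \<in> zigzag J d'" by simp
  next
    fix x y assume xy: "x \<in> pverts X" "y \<in> pverts X" "(x, y) \<notin> parcs X"
    \<comment> \<open>Arrows preserve non-adjacency, so some bag of \<open>d\<close> witnesses it in
      \<open>Y\<close>; the pullback square lifts this witness to \<open>d'\<close>.\<close>
    then have "(vmap f x, vmap f y) \<notin> parcs Y" using vmap_edge[OF f] by blast
    then obtain i a b where i: "i \<in> Ob J" "a \<in> pverts (fobj d i)" "b \<in> pverts (fobj d i)"
      "vmap (\<iota> i) a = vmap f x" "vmap (\<iota> i) b = vmap f y" "(a, b) \<notin> parcs (fobj d i)"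
      using glued_nonadjacent[OF g vmap_in[OF f xy(1)] vmap_in[OF f xy(2)]] by blast
    show "\<exists>i \<in> Ob J. \<exists>a \<in> pverts (fobj d' i). \<exists>b \<in> pverts (fobj d' i).
        vmap (p i) a = x \<and> vmap (p i) b = y \<and> (a, b) \<notin> parcs (fobj d' i)"
      using lift2[OF i(1) xy(1,2) i(2,3) i(4)[symmetric] i(5)[symmetric] xy(3) i(6)] i(1) by blast
  qed
qed

section \<open>The axioms of a width category\<close>

lemma Trees_graphs: "T \<in> Trees \<Longrightarrow> T \<in> graphs"
  by (simp add: Trees_def)

lemma Disc_1_Trees: "Disc 1 \<in> Trees"
proof -
  have "\<not> pre_digraph.cycle (with_proj (Disc 1)) c" if "3 \<le> length c" for c
    using that by (cases c) (auto simp: pre_digraph.cycle_def pre_digraph.awalk_def)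
  moreover have "Digraph_Component.connected (with_proj (Disc 1))"
    by (auto simp: Digraph_Component.connected_def strongly_connected_def mk_symmetric_def
        reachable_def intro: rtrancl_on.intros)
  ultimately show ?thesis using Disc_graphs by (auto simp: Trees_def)
qed

lemma Gr_bar_width_category: "width_category Gr_bar Trees Disc_spine"
proof
  show "Trees \<subseteq> graphs" using Trees_graphs by blast
  show "Disc 1 \<in> Trees" by (rule Disc_1_Trees)
  have shape: "category (elements G)" "finite (Ob (elements G))" "is_functor (elements G) Gr_bar d"
    if "structured_decomposition Gr_bar Trees G d" for G d
    using that elements_category elements_finite Trees_pair_graph
    by (auto simp: structured_decomposition_def)
  show "\<exists>L \<iota>. is_colimit (elements G) Gr_bar d L \<iota>"
    if "structured_decomposition Gr_bar Trees G d" for G d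
    using glued_exists[OF shape[OF that]] glued_colimit[OF shape(3)[OF that]] by blast
  show "Disc_spine n \<subseteq> Ob Gr_bar" "Disc_spine n \<subseteq> Disc_spine (Suc n)" for n
    using Disc_graphs by (auto simp: Disc_spine_eq)
  show "Y \<in> Disc_spine n" if X: "X \<in> Disc_spine n" and XY: "isomorphic Gr_bar X Y" for X Y n
  proof -
    obtain m where "X = Disc m" "m \<le> n" using X by (auto simp: Disc_spine_eq)
    moreover have "isomorphic Gr_bar Y X" using XY by (auto simp: isomorphic_def)
    ultimately show ?thesis using isomorphic_Disc by (auto simp: Disc_spine_eq)
  qed
  show "\<exists>W \<in> \<Union>n. Disc_spine n. \<exists>f \<in> hom_set Gr_bar X W. monic Gr_bar f" if "X \<in> Ob Gr_bar" for X
    using monic_into_spine_iff[of X "card (pverts X)"] that by auto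
  show "\<not> (\<exists>W' \<in> Disc_spine (n - 1). \<exists>f \<in> hom_set Gr_bar W W'. monic Gr_bar f)"
    if W: "W \<in> Disc_spine n - Disc_spine (n - 1)" for n W
  proof -
    obtain m where "W = Disc m" "\<not> m \<le> n - 1" using W by (auto simp: Disc_spine_eq)
    then show ?thesis using monic_into_spine_iff[OF Disc_graphs] by simp
  qed
  show "\<exists>P p q. is_pullback Gr_bar f g P p q"
    if "monic Gr_bar f" "g \<in> Ar Gr_bar" "Cod Gr_bar f = Cod Gr_bar g" for f g
    using that by (intro pullback_exists) (auto simp: hom_set_def monic_def)
  show "\<exists>d' p q. is_pullback_cocone (elements G) Gr_bar d \<iota> f d' p q \<and>
      is_colimit (elements G) Gr_bar d' X p"
    if d: "structured_decomposition Gr_bar Trees G d" and Y: "is_colimit (elements G) Gr_bar d Y \<iota>"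
      and "monic Gr_bar f" and f: "f \<in> hom_set Gr_bar X Y" for G d Y \<iota> f X
  proof -
    note sh = shape[OF d]
    have g: "glued (elements G) d Y \<iota>" using colimit_glued[OF sh Y] .
    note c = glued_cocone[OF g]
    obtain d' p q where pb: "is_pullback_cocone (elements G) Gr_bar d \<iota> f d' p q"
      using Gr.pullback_cocone_exists[OF sh(1,3) c f] pullback_exists[OF f cocone_hom[OF c]] by blast
    moreover have "is_functor (elements G) Gr_bar d'" using pb by (simp add: is_pullback_cocone_def)
    ultimately show ?thesis
      using glued_colimit glued_pullback[OF sh(1,3) g f pb] by blast
  qed
qed

section \<open>Tree decompositions\<close>

text \<open>The induced subgraphs on the sets \<open>B i\<close> have to be renumbered:
  \<open>e i\<close> enumerates \<open>B i\<close>, and the inclusions become the maps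
  \<open>r u\<close>. Functoriality and naturality hold because \<open>e\<close> turns every
  \<open>r u\<close> back into an inclusion and is injective on each object.\<close>

lemma subgraph_diagram:
  assumes J: "category J" and G: "G \<in> graphs"
    and B: "\<And>i. i \<in> Ob J \<Longrightarrow> B i \<subseteq> pverts G"
    and mono: "\<And>u. u \<in> Ar J \<Longrightarrow> B (Dom J u) \<subseteq> B (Cod J u)"
  obtains d \<iota> where "is_functor J Gr_bar d" "is_cocone J Gr_bar d G \<iota>"
    "\<And>u. u \<in> Ar J \<Longrightarrow> monic Gr_bar (farr d u)"
    "\<And>i. i \<in> Ob J \<Longrightarrow> bij_betw (vmap (\<iota> i)) (pverts (fobj d i)) (B i)"
    "\<And>i a b. \<lbrakk>i \<in> Ob J; (a, b) \<in> parcs (fobj d i)\<rbrakk> \<Longrightarrow> (vmap (\<iota> i) a, vmap (\<iota> i) b) \<in> parcs G"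
proof -
  interpret J: category J by fact
  have "\<exists>e. bij_betw e {..<card (B i)} (B i)" if "i \<in> Ob J" for i
    using finite_enumeration finite_subset[OF B[OF that] graphs_finite[OF G]] by blast
  then obtain e where e: "\<And>i. i \<in> Ob J \<Longrightarrow> bij_betw (e i) {..<card (B i)} (B i)" by metis
  define H :: "'a \<Rightarrow> nat pair_pre_digraph" where "H i = \<lparr>pverts = {..<card (B i)},
    parcs = {(a, b). a < card (B i) \<and> b < card (B i) \<and> (e i a, e i b) \<in> parcs G}\<rparr>" for i
  have V: "a \<in> pverts (H i) \<longleftrightarrow> a < card (B i)" for i a by (simp add: H_def)
  have H: "H i \<in> graphs" for i
    by (rule graphsI[of _ "card (B i)"]) (use graphs_irrefl[OF G] graphs_sym[OF G] in \<open>auto simp: H_def\<close>)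
  have eB: "e i a \<in> B i" if "i \<in> Ob J" "a \<in> pverts (H i)" for i a
    using bij_betwE[OF e[OF that(1)]] that(2) by (simp add: V)
  have e_inj: "a = b" if "i \<in> Ob J" "a \<in> pverts (H i)" "b \<in> pverts (H i)" "e i a = e i b" for i a b
    using inj_onD[OF bij_betw_imp_inj_on[OF e[OF that(1)]] that(4)] that by (simp add: V)
  define r where "r u a = (SOME b. b \<in> pverts (H (Cod J u)) \<and> e (Cod J u) b = e (Dom J u) a)" for u a
  have r: "r u a \<in> pverts (H (Cod J u)) \<and> e (Cod J u) (r u a) = e (Dom J u) a"
    if u: "u \<in> Ar J" and a: "a \<in> pverts (H (Dom J u))" for u a
  proof -
    have "e (Dom J u) a \<in> e (Cod J u) ` {..<card (B (Cod J u))}"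
      using bij_betw_imp_surj_on[OF e[OF J.Cod_in[OF u]]] eB[OF J.Dom_in[OF u] a] mono[OF u] by blast
    then have "\<exists>b. b \<in> pverts (H (Cod J u)) \<and> e (Cod J u) b = e (Dom J u) a"
      unfolding V by fastforce
    then show ?thesis unfolding r_def by (rule someI_ex)
  qed
  define d :: "('a, 'b, nat pair_pre_digraph, gr_arr) diagram" where
    "d = \<lparr>fobj = H, farr = (\<lambda>u. gr_map (H (Dom J u)) (r u) (H (Cod J u)))\<rparr>"
  define \<iota> where "\<iota> i = gr_map (H i) (e i) G" for i
  have fo: "fobj d i = H i" for i by (simp add: d_def)
  have \<iota>: "\<iota> i \<in> hom_set Gr_bar (H i) G" if "i \<in> Ob J" for i
    unfolding \<iota>_def using eB[OF that] B[OF that] by (intro gr_map_hom H G) (auto simp: H_def)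
  have fa: "farr d u \<in> hom_set Gr_bar (H (Dom J u)) (H (Cod J u))" if "u \<in> Ar J" for u
    unfolding d_def diagram.simps using r[OF that] by (intro gr_map_hom H) (auto simp: H_def)
  have va: "vmap (farr d u) a \<in> pverts (H (Cod J u))" "e (Cod J u) (vmap (farr d u) a) = e (Dom J u) a"
    if "u \<in> Ar J" "a \<in> pverts (H (Dom J u))" for u a
    using r[OF that] that by (simp_all add: d_def)
  have func: "is_functor J Gr_bar d"
    unfolding is_functor_def fo
  proof (intro conjI ballI impI)
    fix i assume i: "i \<in> Ob J"
    then show "H i \<in> Ob Gr_bar" using H by simp
    have fi: "farr d (Id J i) \<in> hom_set Gr_bar (H i) (H i)"
      using fa[OF J.Id_in[OF i]] i by (simp add: J.Dom_Id J.Cod_Id)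
    show "farr d (Id J i) = Id Gr_bar (H i)"
    proof (rule Gr_bar_ext[OF fi Gr.id_hom])
      fix a assume a: "a \<in> pverts (H i)"
      then show "vmap (farr d (Id J i)) a = vmap (Id Gr_bar (H i)) a"
        using e_inj[OF i vmap_in[OF fi a] a] va[OF J.Id_in[OF i], of a] i
        by (simp add: J.Dom_Id J.Cod_Id)
    qed (use H in simp)
  next
    fix u v assume u: "u \<in> Ar J" and v: "v \<in> Ar J" and uv: "Cod J u = Dom J v"
    have vu: "v \<odot>\<^bsub>J\<^esub> u \<in> Ar J" using u v uv by (rule J.Comp_in)
    have D: "Dom J (v \<odot>\<^bsub>J\<^esub> u) = Dom J u" "Cod J (v \<odot>\<^bsub>J\<^esub> u) = Cod J v"
      using u v uv J.Dom_Comp J.Cod_Comp by auto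
    have f1: "farr d (v \<odot>\<^bsub>J\<^esub> u) \<in> hom_set Gr_bar (H (Dom J u)) (H (Cod J v))"
      using fa[OF vu] D by simp
    have fu: "farr d u \<in> hom_set Gr_bar (H (Dom J u)) (H (Dom J v))" using fa[OF u] uv by simp
    have f2: "farr d v \<odot>\<^bsub>Gr_bar\<^esub> farr d u \<in> hom_set Gr_bar (H (Dom J u)) (H (Cod J v))"
      using Gr.comp_hom[OF fu fa[OF v]] .
    show "farr d (v \<odot>\<^bsub>J\<^esub> u) = farr d v \<odot>\<^bsub>Gr_bar\<^esub> farr d u"
    proof (rule Gr_bar_ext[OF f1 f2])
      fix a assume a: "a \<in> pverts (H (Dom J u))"
      have "e (Cod J v) (vmap (farr d (v \<odot>\<^bsub>J\<^esub> u)) a) = e (Dom J u) a"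
        using va(2)[OF vu, of a] a D by simp
      moreover have "e (Cod J v) (vmap (farr d v \<odot>\<^bsub>Gr_bar\<^esub> farr d u) a) = e (Dom J u) a"
        using va(2)[OF v vmap_in[OF fu a]] va(2)[OF u a] vmap_comp[OF fu a] uv by simp
      ultimately show "vmap (farr d (v \<odot>\<^bsub>J\<^esub> u)) a = vmap (farr d v \<odot>\<^bsub>Gr_bar\<^esub> farr d u) a"
        using e_inj[OF J.Cod_in[OF v] vmap_in[OF f1 a] vmap_in[OF f2 a]] by simp
    qed
  qed (use fa in blast)
  have cocone: "is_cocone J Gr_bar d G \<iota>"
    unfolding is_cocone_def fo
  proof (intro conjI ballI)
    fix u assume u: "u \<in> Ar J"
    note Ob = J.Dom_in[OF u] J.Cod_in[OF u]
    show "\<iota> (Cod J u) \<odot>\<^bsub>Gr_bar\<^esub> farr d u = \<iota> (Dom J u)"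
    proof (rule Gr_bar_ext[OF Gr.comp_hom[OF fa[OF u] \<iota>[OF Ob(2)]] \<iota>[OF Ob(1)]])
      fix a assume a: "a \<in> pverts (H (Dom J u))"
      then show "vmap (\<iota> (Cod J u) \<odot>\<^bsub>Gr_bar\<^esub> farr d u) a = vmap (\<iota> (Dom J u)) a"
        using vmap_comp[OF fa[OF u] a] va[OF u a] by (simp add: \<iota>_def)
    qed
  qed (use G \<iota> in auto)
  have "monic Gr_bar (farr d u)" if u: "u \<in> Ar J" for u
    unfolding monic_iff_inj[OF fa[OF u]]
  proof (rule inj_onI)
    fix a b assume "a \<in> pverts (H (Dom J u))" "b \<in> pverts (H (Dom J u))"
      "vmap (farr d u) a = vmap (farr d u) b"
    then show "a = b" using e_inj[OF J.Dom_in[OF u]] va(2)[OF u] by metis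
  qed
  moreover have "bij_betw (vmap (\<iota> i)) (pverts (fobj d i)) (B i)" if "i \<in> Ob J" for i
  proof -
    have "bij_betw (e i) (pverts (H i)) (B i)" using e[OF that] by (simp add: H_def)
    then show ?thesis
      unfolding fo \<iota>_def by (subst bij_betw_cong[where g = "e i"]) simp_all
  qed
  moreover have "(vmap (\<iota> i) a, vmap (\<iota> i) b) \<in> parcs G" if "(a, b) \<in> parcs (fobj d i)" for i a b
    using that by (auto simp: fo \<iota>_def gr_map_def H_def)
  ultimately show thesis using that[OF func cocone] by blast
qed

section \<open>Translation between tree decompositions and structured decompositions\<close>

lemma elements_simps [simp]:
  "Ob (elements T) = Vertex ` pverts T \<union> Edge ` edges T"
  "Dom (elements T) (Ident i) = i" "Cod (elements T) (Ident i) = i"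
  "Dom (elements T) (Incl e x) = Edge e" "Cod (elements T) (Incl e x) = Vertex x"
  "Incl e x \<in> Ar (elements T) \<longleftrightarrow> e \<in> edges T \<and> x \<in> e"
  by (auto simp: elements_def)

lemma elements_arE:
  assumes "u \<in> Ar (elements T)"
  obtains (Ident) i where "i \<in> Ob (elements T)" "u = Ident i"
    | (Incl) e x where "e \<in> edges T" "x \<in> e" "u = Incl e x"
  using assms by (auto simp: elements_def)

lemma edgesE:
  assumes "pair_graph T" "e \<in> edges T" "x \<in> e"
  obtains y where "e = {x, y}" "(x, y) \<in> parcs T" "x \<in> pverts T" "y \<in> pverts T"
proof -
  interpret pair_graph T by fact
  obtain a b where ab: "e = {a, b}" "(a, b) \<in> parcs T" using assms(2) by (auto simp: edges_def)
  have "(b, a) \<in> parcs T" using arcs_symmetric[OF ab(2)] .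
  then show thesis using ab assms(3) in_arcsD1 in_arcsD2 that by blast
qed

lemma edges_nonempty: "e \<in> edges T \<Longrightarrow> e \<noteq> {}"
  by (auto simp: edges_def)

text \<open>An edge of the tree carries the intersection of the bags at its ends, so a zigzag can
  cross it exactly at the shared vertices. By the intersection condition, all copies of a vertex are
  linked along tree paths.\<close>

lemma tree_decomposition_structured:
  assumes G: "G \<in> graphs" and td: "tree_decomposition (complement G) T X"
  obtains d where "decomposition_of Gr_bar Trees T d G"
    "\<And>t. t \<in> pverts T \<Longrightarrow> card (pverts (fobj d (Vertex t))) = card (X t)"
proof -
  have T: "T \<in> Trees" using td by (simp add: tree_decomposition_def)
  have XG: "X t \<subseteq> pverts G" if "t \<in> pverts T" for t
    using td that by (simp add: tree_decomposition_def complement_def)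
  have cover: "\<exists>t \<in> pverts T. x \<in> X t" if "x \<in> pverts G" for x
    using td that by (auto simp: tree_decomposition_def complement_def)
  have edge: "\<exists>t \<in> pverts T. x \<in> X t \<and> y \<in> X t"
    if "x \<in> pverts G" "y \<in> pverts G" "(x, y) \<notin> parcs G" for x y
  \<comment> \<open>The complement has no loops, so for \<open>x = y\<close> the bag comes from the
    covering condition instead of the edge condition.\<close>
  proof (cases "x = y")
    case False
    then have "(x, y) \<in> parcs (complement G)" using that by (simp add: complement_def)
    then show ?thesis using td unfolding tree_decomposition_def by blast
  qed (use cover that in blast)
  have path: "X t1 \<inter> X t3 \<subseteq> X t2"
    if "pre_digraph.apath (with_proj T) t1 c t3" "t2 \<in> set (pawalk_verts t1 c)" for t1 t2 t3 c
    using td that unfolding tree_decomposition_def by blast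
  have Tg: "pair_graph T" using T by (rule Trees_pair_graph)
  then interpret T: pair_graph T .
  let ?J = "elements T"
  have J: "category ?J" using Tg by (rule elements_category)
  define B where "B i = (case i of Vertex t \<Rightarrow> X t | Edge e \<Rightarrow> \<Inter>t\<in>e. X t)" for i
  have BG: "B i \<subseteq> pverts G" if i: "i \<in> Ob ?J" for i
  proof (cases i)
    case (Edge e)
    then have "e \<in> edges T" using i by auto
    then obtain t where "t \<in> e" "t \<in> pverts T" using edges_nonempty edgesE[OF Tg] by (metis ex_in_conv)
    then show ?thesis using XG Edge by (auto simp: B_def)
  qed (use i XG in \<open>auto simp: B_def\<close>)
  have mono: "B (Dom ?J u) \<subseteq> B (Cod ?J u)" if "u \<in> Ar ?J" for u
    using that by (cases rule: elements_arE) (auto simp: B_def)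
  obtain d \<iota> where d: "is_functor ?J Gr_bar d" and \<iota>: "is_cocone ?J Gr_bar d G \<iota>"
    and mon: "\<And>u. u \<in> Ar ?J \<Longrightarrow> monic Gr_bar (farr d u)"
    and bij: "\<And>i. i \<in> Ob ?J \<Longrightarrow> bij_betw (vmap (\<iota> i)) (pverts (fobj d i)) (B i)"
    and arc: "\<And>i a b. i \<in> Ob ?J \<Longrightarrow> (a, b) \<in> parcs (fobj d i) \<Longrightarrow>
      (vmap (\<iota> i) a, vmap (\<iota> i) b) \<in> parcs G"
    using subgraph_diagram[OF J G BG mono] by blast
  have pre: "\<exists>a \<in> pverts (fobj d i). vmap (\<iota> i) a = x" if "i \<in> Ob ?J" "x \<in> B i" for i x
  proof -
    have "x \<in> vmap (\<iota> i) ` pverts (fobj d i)"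
      using bij_betw_imp_surj_on[OF bij[OF that(1)]] that(2) by simp
    then show ?thesis by blast
  qed
  have inj: "a = b" if "i \<in> Ob ?J" "a \<in> pverts (fobj d i)" "b \<in> pverts (fobj d i)"
    "vmap (\<iota> i) a = vmap (\<iota> i) b" for i a b
    using inj_onD[OF bij_betw_imp_inj_on[OF bij[OF that(1)]] that(4)] that by blast
  \<comment> \<open>Tree paths join vertices of the tree, so a representative over an edge is first
    moved to an end of that edge.\<close>
  have to_vertex: "\<exists>t b. t \<in> pverts T \<and> b \<in> pverts (fobj d (Vertex t)) \<and>
      vmap (\<iota> (Vertex t)) b = vmap (\<iota> i) a \<and> ((i, a), (Vertex t, b)) \<in> zigzag ?J d"
    if i: "i \<in> Ob ?J" and a: "a \<in> pverts (fobj d i)" for i a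
  proof (cases i)
    case (Vertex t)
    then show ?thesis using i a zigzag_refl by (intro exI[of _ t] exI[of _ a]) auto
  next
    case (Edge e)
    then have e: "e \<in> edges T" using i by auto
    then obtain t where t: "t \<in> e" "t \<in> pverts T" using edges_nonempty edgesE[OF Tg] by (metis ex_in_conv)
    then have u: "Incl e t \<in> Ar ?J" using e by simp
    have "a \<in> pverts (fobj d (Dom ?J (Incl e t)))" using a Edge by simp
    then show ?thesis
      using zigzag_step[OF u] cocone_vmap[OF d \<iota> u] vmap_in[OF functor_hom[OF d u]] t Edge
      by (intro exI[of _ t] exI[of _ "vmap (farr d (Incl e t)) a"]) simp
  qed
  \<comment> \<open>Each arc of the walk is crossed through the copy of \<open>x\<close> in the bag
    of the edge; injectivity of the legs identifies its image with the copy already reached.\<close>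
  have walk: "((Vertex s, a), (Vertex t, b)) \<in> zigzag ?J d"
    if "T.awalk s c t" "\<And>r. r \<in> set (pawalk_verts s c) \<Longrightarrow> x \<in> X r"
      "a \<in> pverts (fobj d (Vertex s))" "vmap (\<iota> (Vertex s)) a = x"
      "b \<in> pverts (fobj d (Vertex t))" "vmap (\<iota> (Vertex t)) b = x" for s c t a b x
    using that
  proof (induction c arbitrary: s a)
    case Nil
    then have "s = t" "Vertex s \<in> Ob ?J" by (auto simp: T.awalk_Nil_iff)
    then show ?case using inj[of "Vertex s" a b] Nil zigzag_refl by simp
  next
    case (Cons e c)
    obtain s' where e: "e = (s, s')" "(s, s') \<in> parcs T" "T.awalk s' c t"
      using Cons.prems(1) by (cases e) (auto simp: T.awalk_Cons_iff)
    have E: "{s, s'} \<in> edges T" using e(2) by (auto simp: edges_def)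
    have V: "Vertex s \<in> Ob ?J" "Vertex s' \<in> Ob ?J" "Edge {s, s'} \<in> Ob ?J"
      using E e(2) T.in_arcsD1 T.in_arcsD2 by auto
    have "s' \<in> set (pawalk_verts s' c)" using T.hd_in_awalk_verts(1)[OF e(3)] .
    then have "x \<in> X s" "x \<in> X s'" using Cons.prems(2) e(1) by simp_all
    then have "x \<in> B (Edge {s, s'})" by (simp add: B_def)
    then obtain k where k: "k \<in> pverts (fobj d (Edge {s, s'}))" "vmap (\<iota> (Edge {s, s'})) k = x"
      using pre V(3) by blast
    have u: "Incl {s, s'} s \<in> Ar ?J" "Incl {s, s'} s' \<in> Ar ?J" using E by simp_all
    let ?a = "vmap (farr d (Incl {s, s'} s)) k" and ?a' = "vmap (farr d (Incl {s, s'} s')) k"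
    have a: "?a \<in> pverts (fobj d (Vertex s))" "vmap (\<iota> (Vertex s)) ?a = x"
      "((Edge {s, s'}, k), (Vertex s, ?a)) \<in> zigzag ?J d"
      using vmap_in[OF functor_hom[OF d u(1)], of k] cocone_vmap[OF d \<iota> u(1), of k]
        zigzag_step[OF u(1), of k d] k by simp_all
    have a': "?a' \<in> pverts (fobj d (Vertex s'))" "vmap (\<iota> (Vertex s')) ?a' = x"
      "((Edge {s, s'}, k), (Vertex s', ?a')) \<in> zigzag ?J d"
      using vmap_in[OF functor_hom[OF d u(2)], of k] cocone_vmap[OF d \<iota> u(2), of k]
        zigzag_step[OF u(2), of k d] k by simp_all
    have "a = ?a" using inj[OF V(1) Cons.prems(3) a(1)] Cons.prems(4) a(2) by simp
    then have "((Vertex s, a), (Vertex s', ?a')) \<in> zigzag ?J d"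
      using zigzag_trans[OF zigzag_sym[OF a(3)] a'(3)] by simp
    moreover have "((Vertex s', ?a'), (Vertex t, b)) \<in> zigzag ?J d"
      using Cons.IH[OF e(3) _ a'(1,2) Cons.prems(5,6)] Cons.prems(2) e(1) by simp
    ultimately show ?case by (rule zigzag_trans)
  qed
  have "glued ?J d G \<iota>"
    unfolding glued_def
  proof (intro conjI ballI impI)
    show "is_cocone ?J Gr_bar d G \<iota>" by (rule \<iota>)
    fix i j a b assume h: "i \<in> Ob ?J" "j \<in> Ob ?J" "a \<in> pverts (fobj d i)" "b \<in> pverts (fobj d j)"
      "vmap (\<iota> i) a = vmap (\<iota> j) b"
    obtain s a' where s: "s \<in> pverts T" "a' \<in> pverts (fobj d (Vertex s))"
      "vmap (\<iota> (Vertex s)) a' = vmap (\<iota> i) a" "((i, a), (Vertex s, a')) \<in> zigzag ?J d"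
      using to_vertex[OF h(1,3)] by blast
    obtain t b' where t: "t \<in> pverts T" "b' \<in> pverts (fobj d (Vertex t))"
      "vmap (\<iota> (Vertex t)) b' = vmap (\<iota> j) b" "((j, b), (Vertex t, b')) \<in> zigzag ?J d"
      using to_vertex[OF h(2,4)] by blast
    obtain c where c: "T.apath s c t" using Trees_apath[OF T s(1) t(1)] by blast
    have x: "vmap (\<iota> i) a \<in> X s \<inter> X t"
      using bij_betwE[OF bij[of "Vertex s"]] bij_betwE[OF bij[of "Vertex t"]] s t h(5)
      by (auto simp: B_def)
    have "((Vertex s, a'), (Vertex t, b')) \<in> zigzag ?J d"
    proof (rule walk)
      show "T.awalk s c t" using c by (rule T.awalkI_apath)
      show "vmap (\<iota> i) a \<in> X r" if "r \<in> set (pawalk_verts s c)" for r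
        using path[OF c that] x by blast
    qed (use s t h(5) in simp_all)
    then show "((i, a), (j, b)) \<in> zigzag ?J d"
      using zigzag_trans[OF zigzag_trans[OF s(4)] zigzag_sym[OF t(4)]] by blast
  next
    fix x y assume xy: "x \<in> pverts G" "y \<in> pverts G" "(x, y) \<notin> parcs G"
    then obtain t where t: "t \<in> pverts T" "x \<in> X t" "y \<in> X t" using edge by blast
    then have i: "Vertex t \<in> Ob ?J" by simp
    obtain a where a: "a \<in> pverts (fobj d (Vertex t))" "vmap (\<iota> (Vertex t)) a = x"
      using pre[OF i] t by (auto simp: B_def)
    obtain b where b: "b \<in> pverts (fobj d (Vertex t))" "vmap (\<iota> (Vertex t)) b = y"
      using pre[OF i] t by (auto simp: B_def)
    have "(a, b) \<notin> parcs (fobj d (Vertex t))" using arc[OF i] a b xy by blast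
    then show "\<exists>i \<in> Ob ?J. \<exists>a \<in> pverts (fobj d i). \<exists>b \<in> pverts (fobj d i).
        vmap (\<iota> i) a = x \<and> vmap (\<iota> i) b = y \<and> (a, b) \<notin> parcs (fobj d i)"
      using i a b by blast
  qed
  then have "decomposition_of Gr_bar Trees T d G"
    unfolding decomposition_of_def structured_decomposition_def
    using T d mon glued_colimit[OF d] isomorphic_refl[OF G] by blast
  moreover have "card (pverts (fobj d (Vertex t))) = card (X t)" if "t \<in> pverts T" for t
    using bij_betw_same_card[OF bij[of "Vertex t"]] that by (simp add: B_def)
  ultimately show thesis by (rule that)
qed

text \<open>A vertex that has copies in two bags gives a zigzag between the copies. Its trace on the
  tree is a walk through bags containing that vertex, and acyclicity extends this to the whole tree
  path.\<close>

lemma glued_tree_decomposition: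
  assumes T: "T \<in> Trees" and d: "is_functor (elements T) Gr_bar d"
    and g: "glued (elements T) d G \<iota>"
  shows "tree_decomposition (complement G) T (\<lambda>t. vmap (\<iota> (Vertex t)) ` pverts (fobj d (Vertex t)))"
    (is "tree_decomposition _ _ ?X")
proof -
  have Tg: "pair_graph T" using T by (rule Trees_pair_graph)
  then interpret T: pair_graph T .
  let ?J = "elements T"
  note c = glued_cocone[OF g]
  note \<iota> = cocone_hom[OF c]
  have G: "G \<in> graphs" using c by (rule cocone_apex)
  \<comment> \<open>Whatever lies over an edge of the tree already occurs in the bags at both ends,
    so the vertex bags suffice.\<close>
  have push: "vmap (\<iota> (Edge e)) a \<in> ?X t" "vmap (farr d (Incl e t)) a \<in> pverts (fobj d (Vertex t))"
    "vmap (\<iota> (Vertex t)) (vmap (farr d (Incl e t)) a) = vmap (\<iota> (Edge e)) a"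
    if "e \<in> edges T" "t \<in> e" "a \<in> pverts (fobj d (Edge e))" for e t a
  proof -
    have u: "Incl e t \<in> Ar ?J" using that by simp
    show 1: "vmap (farr d (Incl e t)) a \<in> pverts (fobj d (Vertex t))"
      using vmap_in[OF functor_hom[OF d u], of a] that by simp
    show 2: "vmap (\<iota> (Vertex t)) (vmap (farr d (Incl e t)) a) = vmap (\<iota> (Edge e)) a"
      using cocone_vmap[OF d c u, of a] that by simp
    show "vmap (\<iota> (Edge e)) a \<in> ?X t" using 1 2 by (metis imageI)
  qed
  have bag: "\<exists>t \<in> pverts T. x \<in> ?X t \<and> y \<in> ?X t"
    if xy: "x \<in> pverts G" "y \<in> pverts G" "(x, y) \<notin> parcs G" for x y
  proof -
    obtain i a b where i: "i \<in> Ob ?J" "a \<in> pverts (fobj d i)" "b \<in> pverts (fobj d i)"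
      "vmap (\<iota> i) a = x" "vmap (\<iota> i) b = y"
      using glued_nonadjacent[OF g xy] by blast
    show ?thesis
    proof (cases i)
      case (Vertex t)
      then show ?thesis using i by (intro bexI[of _ t]) auto
    next
      case (Edge e)
      then have e: "e \<in> edges T" using i by auto
      then obtain t where t: "t \<in> e" "t \<in> pverts T"
        using edges_nonempty edgesE[OF Tg] by (metis ex_in_conv)
      then show ?thesis using push(1)[OF e t(1)] i Edge by blast
    qed
  qed
  have connected: "?X t1 \<inter> ?X t3 \<subseteq> ?X t2"
    if path: "T.apath t1 p t3" and t2: "t2 \<in> set (pawalk_verts t1 p)" for t1 t2 t3 p
  proof
    fix x assume x: "x \<in> ?X t1 \<inter> ?X t3"
    have t13: "t1 \<in> pverts T" "t3 \<in> pverts T" using T.awalkI_apath[OF path] by auto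
    obtain a b where a: "a \<in> pverts (fobj d (Vertex t1))" "vmap (\<iota> (Vertex t1)) a = x"
      and b: "b \<in> pverts (fobj d (Vertex t3))" "vmap (\<iota> (Vertex t3)) b = x" using x by auto
    define W where "W = {t \<in> pverts T. x \<in> ?X t}"
    let ?R = "(parcs T \<inter> W \<times> W)\<^sup>*"
    have "((Vertex t1, a), (Vertex t3, b)) \<in> zigzag ?J d"
      using glued_zigzag[OF g _ _ a(1) b(1)] t13 a b by simp
    \<comment> \<open>At an edge object every end is required to be reachable. Passing from an edge
      to an end is then immediate, and only the passage from an end to the edge has to add the other
      end.\<close>
    moreover have "vmap (\<iota> (fst s)) (snd s) = x \<and>
        (case fst s of Vertex t \<Rightarrow> (t1, t) \<in> ?R | Edge e \<Rightarrow> \<forall>t \<in> e. (t1, t) \<in> ?R)"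
      if "((Vertex t1, a), s) \<in> zigzag ?J d" for s
      using that unfolding zigzag_def
    proof (induction rule: rtrancl_induct)
      case base
      show ?case using a by simp
    next
      case (step s s')
      have "((Vertex t1, a), s') \<in> zigzag ?J d"
        using rtrancl_into_rtrancl[OF step.hyps] unfolding zigzag_def .
      from cocone_zigzag[OF d c this] have x': "vmap (\<iota> (fst s')) (snd s') = x" using a(2) by simp
      from step.hyps(2) obtain u k where u: "u \<in> Ar ?J" "k \<in> pverts (fobj d (Dom ?J u))"
        and ss: "s = (Dom ?J u, k) \<and> s' = (Cod ?J u, vmap (farr d u) k) \<or>
          s' = (Dom ?J u, k) \<and> s = (Cod ?J u, vmap (farr d u) k)"
        by (auto simp: fibre_step_def)
      from u(1) show ?case
      proof (cases rule: elements_arE)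
        case (Ident i)
        then have "fst s = fst s'" using ss by auto
        then show ?thesis using step.IH x' by simp
      next
        case (Incl e t)
        from ss show ?thesis
        proof
          assume "s = (Dom ?J u, k) \<and> s' = (Cod ?J u, vmap (farr d u) k)"
          then show ?thesis using step.IH x' Incl by simp
        next
          assume s: "s' = (Dom ?J u, k) \<and> s = (Cod ?J u, vmap (farr d u) k)"
          then have t1t: "(t1, t) \<in> ?R" using step.IH Incl by simp
          have "(t1, r) \<in> ?R" if r: "r \<in> e" for r
          proof (cases "r = t")
            case False
            obtain y where y: "e = {t, y}" "(t, y) \<in> parcs T" "t \<in> pverts T" "y \<in> pverts T"
              using edgesE[OF Tg Incl(1,2)] by blast
            have k: "k \<in> pverts (fobj d (Edge e))" "vmap (\<iota> (Edge e)) k = x"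
              using u(2) s x' Incl by auto
            \<comment> \<open>The leg at the edge takes the value \<open>x\<close>, so the bags at
              both ends contain \<open>x\<close>.\<close>
            have "t \<in> W" "y \<in> W"
              using push(1)[OF Incl(1) _ k(1)] k(2) y unfolding W_def by auto
            then have "(t, y) \<in> parcs T \<inter> W \<times> W" using y by blast
            then show ?thesis using rtrancl_into_rtrancl[OF t1t] False r y(1) by blast
          qed (use t1t in simp)
          then show ?thesis using s x' Incl by simp
        qed
      qed
    qed
    ultimately have "(t1, t3) \<in> ?R" by fastforce
    then have "set (pawalk_verts t1 p) \<subseteq> W"
      using T.apath_verts_in_reachable[OF Trees_no_cycle[OF T] _ path] t13 x
      unfolding W_def by blast
    then show "x \<in> ?X t2" using t2 by (auto simp: W_def)
  qed
  show ?thesis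
    unfolding tree_decomposition_def
  proof (intro conjI)
    show "\<forall>t \<in> pverts T. ?X t \<subseteq> pverts (complement G)"
      using vmap_in[OF \<iota>] by (auto simp: complement_def)
    show "pverts (complement G) \<subseteq> (\<Union>t \<in> pverts T. ?X t)"
    proof
      fix x assume "x \<in> pverts (complement G)"
      then have "x \<in> pverts G" by (simp add: complement_def)
      from bag[OF this this graphs_irrefl[OF G]] show "x \<in> (\<Union>t \<in> pverts T. ?X t)" by blast
    qed
    show "\<forall>(x, y) \<in> parcs (complement G). \<exists>t \<in> pverts T. x \<in> ?X t \<and> y \<in> ?X t"
      using bag by (auto simp: complement_def)
  qed (use T connected in blast)+
qed

section \<open>Width\<close>

text \<open>A least element of either predicate is squeezed between elements of the other and is
  therefore least for both. As \<open>LEAST\<close> is a definite description, the equality does not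
  depend on proving that a minimum exists.\<close>

lemma Least_eqI:
  fixes P Q :: "'a :: order \<Rightarrow> bool"
  assumes "\<And>k. P k \<Longrightarrow> \<exists>k' \<le> k. Q k'" and "\<And>k. Q k \<Longrightarrow> \<exists>k' \<le> k. P k'"
  shows "(LEAST k. P k) = (LEAST k. Q k)"
proof -
  have "P x \<and> (\<forall>y. P y \<longrightarrow> x \<le> y) \<longleftrightarrow> Q x \<and> (\<forall>y. Q y \<longrightarrow> x \<le> y)" for x
    using assms by (metis order_antisym order_trans)
  then show ?thesis unfolding Least_def by simp
qed

lemma decomposition_width_eq:
  assumes "is_functor (elements T) Gr_bar d"
  shows "decomposition_width Gr_bar Disc_spine T d =
    int (Max ((\<lambda>t. card (pverts (fobj d (Vertex t)))) ` pverts T)) - 1"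
proof -
  have "spine_size Gr_bar Disc_spine (fobj d (Vertex t)) = card (pverts (fobj d (Vertex t)))"
    if "t \<in> pverts T" for t
    using spine_size_eq functor_ob[OF assms, of "Vertex t"] that by simp
  then show ?thesis by (simp add: decomposition_width_def cong: image_cong)
qed

text \<open>The new bags are images of the objects of \<open>d\<close> under the legs, whence the
  inequality between cardinalities; this is the direction that comparing minima asks for.\<close>

lemma decomposition_tree_decomposition:
  assumes dec: "decomposition_of Gr_bar Trees T d G"
  obtains X where "tree_decomposition (complement G) T X"
    "\<And>t. t \<in> pverts T \<Longrightarrow> card (X t) \<le> card (pverts (fobj d (Vertex t)))"
proof -
  let ?J = "elements T"
  obtain L \<iota> where T: "T \<in> Trees" and d: "is_functor ?J Gr_bar d"
    and L: "is_colimit ?J Gr_bar d L \<iota>" and iso: "isomorphic Gr_bar G L"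
    using dec unfolding decomposition_of_def structured_decomposition_def by blast
  have Tg: "pair_graph T" using T by (rule Trees_pair_graph)
  note J = elements_category[OF Tg]
  obtain u v where "v \<in> hom_set Gr_bar L G" "u \<in> hom_set Gr_bar G L"
    "u \<odot>\<^bsub>Gr_bar\<^esub> v = Id Gr_bar L" "v \<odot>\<^bsub>Gr_bar\<^esub> u = Id Gr_bar G"
    using isomorphicE[OF iso] by metis
  then obtain \<kappa> where "is_colimit ?J Gr_bar d G \<kappa>" using Gr.colimit_iso[OF d J L] by blast
  then have "glued ?J d G \<kappa>" by (rule colimit_glued[OF J elements_finite[OF Tg] d])
  then have "tree_decomposition (complement G) T
      (\<lambda>t. vmap (\<kappa> (Vertex t)) ` pverts (fobj d (Vertex t)))"
    by (rule glued_tree_decomposition[OF T d])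
  moreover have "card (vmap (\<kappa> (Vertex t)) ` pverts (fobj d (Vertex t))) \<le>
      card (pverts (fobj d (Vertex t)))" if "t \<in> pverts T" for t
    using functor_ob[OF d, of "Vertex t"] that by (intro card_image_le graphs_finite) simp
  ultimately show thesis by (rule that)
qed

lemma width_eq_complemented_treewidth:
  assumes G: "G \<in> graphs"
  shows "width Gr_bar Trees Disc_spine G = complemented_treewidth G"
  unfolding width_def complemented_treewidth_def treewidth_def
proof (rule Least_eqI)
  fix k assume "\<exists>T d. decomposition_of Gr_bar Trees T d G \<and>
    k = decomposition_width Gr_bar Disc_spine T d"
  then obtain T d where dec: "decomposition_of Gr_bar Trees T d G"
    and k: "k = decomposition_width Gr_bar Disc_spine T d" by blast
  have T: "T \<in> Trees" and d: "is_functor (elements T) Gr_bar d"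
    using dec by (auto simp: decomposition_of_def structured_decomposition_def)
  obtain X where X: "tree_decomposition (complement G) T X"
    "\<And>t. t \<in> pverts T \<Longrightarrow> card (X t) \<le> card (pverts (fobj d (Vertex t)))"
    using decomposition_tree_decomposition[OF dec] by blast
  have fin: "finite (pverts T)" using graphs_finite[OF Trees_graphs[OF T]] .
  have "Max ((\<lambda>t. card (X t)) ` pverts T) \<le>
      Max ((\<lambda>t. card (pverts (fobj d (Vertex t)))) ` pverts T)"
    using fin Trees_nonempty[OF T] X(2) by (subst Max_le_iff) (auto intro!: Max_ge_iff[THEN iffD2])
  then show "\<exists>k' \<le> k. \<exists>T X. tree_decomposition (complement G) T X \<and>
      k' = int (Max ((\<lambda>t. card (X t)) ` pverts T)) - 1"
    using X(1) k decomposition_width_eq[OF d]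
    by (intro exI[of _ "int (Max ((\<lambda>t. card (X t)) ` pverts T)) - 1"]) auto
next
  fix k assume "\<exists>T X. tree_decomposition (complement G) T X \<and>
    k = int (Max ((\<lambda>t. card (X t)) ` pverts T)) - 1"
  then obtain T X where td: "tree_decomposition (complement G) T X"
    and k: "k = int (Max ((\<lambda>t. card (X t)) ` pverts T)) - 1" by blast
  obtain d where d: "decomposition_of Gr_bar Trees T d G"
    "\<And>t. t \<in> pverts T \<Longrightarrow> card (pverts (fobj d (Vertex t))) = card (X t)"
    using tree_decomposition_structured[OF G td] by blast
  then have "is_functor (elements T) Gr_bar d"
    by (simp add: decomposition_of_def structured_decomposition_def)
  then have "k = decomposition_width Gr_bar Disc_spine T d"
    using d(2) k by (simp add: decomposition_width_eq cong: image_cong)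
  then show "\<exists>k' \<le> k. \<exists>T d. decomposition_of Gr_bar Trees T d G \<and>
      k' = decomposition_width Gr_bar Disc_spine T d"
    using d(1) by blast
qed

theorem proposition3p3p4:
  shows "width_category Gr_bar Trees Disc_spine \<and>
    (\<forall>G \<in> graphs. width Gr_bar Trees Disc_spine G = complemented_treewidth G)"
  using Gr_bar_width_category width_eq_complemented_treewidth by blast

end
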